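(* Let $G$ be a finitely generated subgroup of $\operatorname{BiLip}_+^{\mathrm{bd}}(\mathbb{R})$, and let $\Gamma$ be a subgroup of $G$ without global fixed points (i.e. there is no $x_0\in\mathbb{R}$ with $g(x_0)=x_0$ for all $g\in\Gamma$). If the pair $(G,\Gamma)$ satisfies Property (T), then, for every finite generating set $S\subset G$, $$\max_{g\in S}\operatorname{BiLip}(g)\geq \Phi\left(\kappa(G,\Gamma,S)\right),$$ where $\Phi:[0,\sqrt{2})\to[1,\infty)$ is defined by $$\Phi(t)=\max\left\{e^{2t},\,4(2-t^2)^{-2}\right\}\quad\forall t\in[0,\sqrt{2}).$$
   Context: $\operatorname{Homeo}_+(\mathbb{R})$ is the group of increasing homeomorphisms of $\mathbb{R}$. An element $f\in\operatorname{Homeo}_+(\mathbb{R})$ is bi-Lipschitz if there is $L\geq 1$ such that $\frac{1}{L}|x-y|\leq|f(x)-f(y)|\leq L|x-y|$ for all $x,y\in\mathbb{R}$; $\operatorname{BiLip}(f)$ is the infimum of all such $L$. It has bounded displacement if $\operatorname{disp}(f)=\sup_{x\in\mathbb{R}}|f(x)-x|<\infty$. $\operatorname{BiLip}_+^{\mathrm{bd}}(\mathbb{R})$ is the subgroup of $\operatorname{Homeo}_+(\mathbb{R})$ of all bi-Lipschitz elements with bounded displacement. Let $G$ be a finitely generated group (regarded as a discrete group) and $\Gamma$ a subgroup. For a finite subset $S\subset G$ and $\varepsilon\geq 0$, $(S,\varepsilon)$ is a Kazhdan pair for $(G,\Gamma)$ if, for every unitary representation $\pi$ of $G$ on a complex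 Hilbert space $\mathcal{H}$ without nonzero $\Gamma$-invariant vectors, $\max_{g\in S}\|\pi(g)\xi-\xi\|\geq\varepsilon\|\xi\|$ for all $\xi\in\mathcal{H}$. The pair $(G,\Gamma)$ has (satisfies) Property (T) if, for every finite generating set $S\subset G$, there is $\varepsilon>0$ such that $(S,\varepsilon)$ is a Kazhdan pair for $(G,\Gamma)$. The Kazhdan constant is $\kappa(G,\Gamma,S)=\sup\{\varepsilon\geq 0 : (S,\varepsilon)\text{ is a Kazhdan pair for }(G,\Gamma)\}$. That $\kappa(G,\Gamma,S)$ lies in the domain $[0,\sqrt{2})$ of $\Phi$ is implicit in the statement. *)

theory Defs
  imports
    "HOL-Analysis.Analysis"
    "HOL-Algebra.Bij"
    "HOL-Algebra.Generated_Groups"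
    "HOL-Algebra.Module"
begin

section \<open>Bi-Lipschitz homeomorphisms of the line with bounded displacement\<close>

definition homeo_plus :: "(real \<Rightarrow> real) monoid" where
  "homeo_plus =
     \<lparr>carrier = {f. strict_mono f \<and> (\<exists>g. homeomorphism UNIV UNIV f g)},
      mult = (\<circ>),
      one = id\<rparr>"

definition bilip_bound :: "(real \<Rightarrow> real) \<Rightarrow> real \<Rightarrow> bool" where
  "bilip_bound f L \<longleftrightarrow>
     1 \<le> L \<and> (\<forall>x y. 1 / L * \<bar>x - y\<bar> \<le> \<bar>f x - f y\<bar> \<and> \<bar>f x - f y\<bar> \<le> L * \<bar>x - y\<bar>)"

definition BiLip :: "(real \<Rightarrow> real) \<Rightarrow> real" where
  "BiLip f = Inf {L. bilip_bound f L}"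

definition bounded_displacement :: "(real \<Rightarrow> real) \<Rightarrow> bool" where
  "bounded_displacement f \<longleftrightarrow> bdd_above (range (\<lambda>x. \<bar>f x - x\<bar>))"

definition bilip_bd_group :: "(real \<Rightarrow> real) monoid" where
  "bilip_bd_group = homeo_plus
     \<lparr>carrier := {f \<in> carrier homeo_plus. (\<exists>L. bilip_bound f L) \<and> bounded_displacement f}\<rparr>"

section \<open>Complex Hilbert spaces and unitary groups\<close>

definition complex_field :: "complex ring" where
  "complex_field = \<lparr>carrier = UNIV, mult = (*), one = 1, zero = 0, add = (+)\<rparr>"

text \<open>Hilbert spaces are carrier-based, so that one can quantify over all of them inside a
  definition. The fields \<open>mult\<close> and \<open>one\<close> inherited from \<open>module\<close> play no role.\<close>

record 'h inner_space = "(complex, 'h) module" +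
  cinner :: "'h \<Rightarrow> 'h \<Rightarrow> complex"

definition hnorm :: "('h, 'b) inner_space_scheme \<Rightarrow> 'h \<Rightarrow> real" where
  "hnorm H x = sqrt (Re (cinner H x x))"

definition hdist :: "('h, 'b) inner_space_scheme \<Rightarrow> 'h \<Rightarrow> 'h \<Rightarrow> real" where
  "hdist H x y = hnorm H (x \<ominus>\<^bsub>H\<^esub> y)"

locale complex_hilbert_space = module complex_field H
  for H :: "('h, 'b) inner_space_scheme" (structure) +
  assumes cinner_add_left:
      "\<lbrakk>x \<in> carrier H; y \<in> carrier H; z \<in> carrier H\<rbrakk>
        \<Longrightarrow> cinner H (x \<oplus> y) z = cinner H x z + cinner H y z"
    and cinner_smult_left:
      "\<lbrakk>x \<in> carrier H; y \<in> carrier H\<rbrakk> \<Longrightarrow> cinner H (a \<odot> x) y = a * cinner H x y"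
    and cinner_commute:
      "\<lbrakk>x \<in> carrier H; y \<in> carrier H\<rbrakk> \<Longrightarrow> cinner H y x = cnj (cinner H x y)"
    and cinner_pos:
      "\<lbrakk>x \<in> carrier H; x \<noteq> \<zero>\<rbrakk> \<Longrightarrow> 0 < Re (cinner H x x)"
    and complete:
      "\<lbrakk>range \<sigma> \<subseteq> carrier H; \<forall>e>0. \<exists>N. \<forall>m\<ge>N. \<forall>n\<ge>N. hdist H (\<sigma> m) (\<sigma> n) < e\<rbrakk>
        \<Longrightarrow> \<exists>x\<in>carrier H. (\<lambda>n. hdist H (\<sigma> n) x) \<longlonglongrightarrow> 0"

definition unitary_group :: "('h, 'b) inner_space_scheme \<Rightarrow> ('h \<Rightarrow> 'h) monoid" where
  "unitary_group H = BijGroup (carrier H)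
     \<lparr>carrier := {U \<in> Bij (carrier H).
        (\<forall>x\<in>carrier H. \<forall>y\<in>carrier H. U (x \<oplus>\<^bsub>H\<^esub> y) = U x \<oplus>\<^bsub>H\<^esub> U y) \<and>
        (\<forall>a. \<forall>x\<in>carrier H. U (a \<odot>\<^bsub>H\<^esub> x) = a \<odot>\<^bsub>H\<^esub> U x) \<and>
        (\<forall>x\<in>carrier H. \<forall>y\<in>carrier H. cinner H (U x) (U y) = cinner H x y)}\<rparr>"

definition no_invariant_vectors ::
  "('h, 'b) inner_space_scheme \<Rightarrow> ('g \<Rightarrow> 'h \<Rightarrow> 'h) \<Rightarrow> 'g set \<Rightarrow> bool" where
  "no_invariant_vectors H \<pi> \<Gamma> \<longleftrightarrow>
     (\<forall>v\<in>carrier H. (\<forall>g\<in>\<Gamma>. \<pi> g v = v) \<longrightarrow> v = \<zero>\<^bsub>H\<^esub>)"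

definition max_displacement ::
  "('h, 'b) inner_space_scheme \<Rightarrow> ('g \<Rightarrow> 'h \<Rightarrow> 'h) \<Rightarrow> 'g set \<Rightarrow> 'h \<Rightarrow> real" where
  \<comment> \<open>\<open>insert 0\<close> only matters for \<open>S = {}\<close>, where \<open>Max\<close> would be unspecified.\<close>
  "max_displacement H \<pi> S \<xi> = Max (insert 0 ((\<lambda>g. hnorm H (\<pi> g \<xi> \<ominus>\<^bsub>H\<^esub> \<xi>)) ` S))"

section \<open>Relative Property (T)\<close>

text \<open>HOL cannot quantify over all types inside a definition. The Hilbert spaces below have their
  underlying set in the type \<open>'g \<Rightarrow> complex\<close>, where \<open>'g\<close> is the type of group elements. This
  is no restriction: by the theorem \<open>kazhdan_pair_all_types\<close> below, the inequality then holds for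
  Hilbert spaces over every type. The reason is that a cyclic representation with cyclic vector
  \<open>\<xi>\<close> embeds into functions on the group by \<open>v \<mapsto> (g \<mapsto> \<langle>v, \<pi> g \<xi>\<rangle>)\<close>.\<close>

definition kazhdan_pair :: "('g, 'b) monoid_scheme \<Rightarrow> 'g set \<Rightarrow> 'g set \<Rightarrow> real \<Rightarrow> bool" where
  "kazhdan_pair G \<Gamma> S \<epsilon> \<longleftrightarrow>
     (\<forall>(H :: ('g \<Rightarrow> complex) inner_space) \<pi>.
        complex_hilbert_space H \<and> \<pi> \<in> hom G (unitary_group H) \<and> no_invariant_vectors H \<pi> \<Gamma> \<longrightarrow>
        (\<forall>\<xi>\<in>carrier H. max_displacement H \<pi> S \<xi> \<ge> \<epsilon> * hnorm H \<xi>))"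

definition finite_generating_set :: "('g, 'b) monoid_scheme \<Rightarrow> 'g set \<Rightarrow> bool" where
  "finite_generating_set G S \<longleftrightarrow> finite S \<and> S \<subseteq> carrier G \<and> generate G S = carrier G"

definition property_T :: "('g, 'b) monoid_scheme \<Rightarrow> 'g set \<Rightarrow> bool" where
  "property_T G \<Gamma> \<longleftrightarrow>
     (\<forall>S. finite_generating_set G S \<longrightarrow> (\<exists>\<epsilon>>0. kazhdan_pair G \<Gamma> S \<epsilon>))"

text \<open>The supremum is taken in the extended reals, since it is infinite in degenerate cases
  (e.g. \<open>\<Gamma>\<close> trivial).\<close>

definition kazhdan_constant :: "('g, 'b) monoid_scheme \<Rightarrow> 'g set \<Rightarrow> 'g set \<Rightarrow> ereal" where
  "kazhdan_constant G \<Gamma> S = Sup {ereal \<epsilon> |\<epsilon>. 0 \<le> \<epsilon> \<and> kazhdan_pair G \<Gamma> S \<epsilon>}"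

definition Phi :: "real \<Rightarrow> real" where
  \<comment> \<open>only meaningful on \<open>{0..<sqrt 2}\<close>\<close>
  "Phi t = max (exp (2 * t)) (4 * (2 - t\<^sup>2) powi (-2))"

section \<open>Well-definedness of the groups\<close>

lemma homeo_plus_iff:
  "f \<in> carrier homeo_plus \<longleftrightarrow> strict_mono f \<and> (\<exists>g. homeomorphism UNIV UNIV f g)"
  by (simp add: homeo_plus_def)

lemma homeo_plus_inverse:
  assumes "f \<in> carrier homeo_plus"
  obtains g where "g \<in> carrier homeo_plus" "\<And>x. g (f x) = x" "\<And>x. f (g x) = x"
proof -
  obtain g where f: "strict_mono f" and g: "homeomorphism UNIV UNIV f g"
    using assms by (auto simp: homeo_plus_iff)
  have gf: "g (f x) = x" and fg: "f (g x) = x" for x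
    using g by (auto simp: homeomorphism_def)
  have "strict_mono g"
    by (rule strict_monoI) (metis f fg strict_mono_less)
  moreover have "homeomorphism UNIV UNIV g f"
    using g by (simp add: homeomorphism_symD)
  ultimately show ?thesis
    using that gf fg by (auto simp: homeo_plus_iff)
qed

theorem group_homeo_plus: "group homeo_plus"
proof (rule groupI)
  fix f g assume "f \<in> carrier homeo_plus" "g \<in> carrier homeo_plus"
  then show "f \<otimes>\<^bsub>homeo_plus\<^esub> g \<in> carrier homeo_plus"
    by (auto simp: homeo_plus_def strict_mono_def intro: homeomorphism_compose)
next
  show "\<one>\<^bsub>homeo_plus\<^esub> \<in> carrier homeo_plus"
    by (auto simp: homeo_plus_def strict_mono_def homeomorphism_def intro!: exI[of _ id])
next
  fix f assume "f \<in> carrier homeo_plus"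
  then show "\<exists>g\<in>carrier homeo_plus. g \<otimes>\<^bsub>homeo_plus\<^esub> f = \<one>\<^bsub>homeo_plus\<^esub>"
    by (rule homeo_plus_inverse) (auto simp: homeo_plus_def fun_eq_iff)
qed (auto simp: homeo_plus_def comp_assoc)

theorem subgroup_bilip_bd: "subgroup (carrier bilip_bd_group) homeo_plus"
proof (rule group.subgroupI[OF group_homeo_plus])
  show "carrier bilip_bd_group \<subseteq> carrier homeo_plus"
    by (auto simp: bilip_bd_group_def)
  have "id \<in> carrier homeo_plus"
    using group.is_monoid[OF group_homeo_plus, THEN monoid.one_closed] by (simp add: homeo_plus_def)
  then have "id \<in> carrier bilip_bd_group"
    by (auto simp: bilip_bd_group_def bilip_bound_def bounded_displacement_def intro!: exI[of _ 1])
  then show "carrier bilip_bd_group \<noteq> {}" by blast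
next
  fix f assume f: "f \<in> carrier bilip_bd_group"
  then have f1: "f \<in> carrier homeo_plus" by (simp add: bilip_bd_group_def)
  obtain g where g: "g \<in> carrier homeo_plus" "\<And>x. g (f x) = x" "\<And>x. f (g x) = x"
    using homeo_plus_inverse[OF f1] by blast
  have "inv\<^bsub>homeo_plus\<^esub> f = g"
    by (rule group.inv_equality[OF group_homeo_plus])
      (use f1 g in \<open>auto simp: homeo_plus_def fun_eq_iff\<close>)
  moreover have "g \<in> carrier bilip_bd_group"
  proof -
    obtain L where L: "bilip_bound f L" using f by (auto simp: bilip_bd_group_def)
    have "bilip_bound g L"
      unfolding bilip_bound_def
    proof (intro conjI allI)
      show L1: "1 \<le> L" using L by (simp add: bilip_bound_def)
      fix x y
      have "1 / L * \<bar>g x - g y\<bar> \<le> \<bar>x - y\<bar>" "\<bar>x - y\<bar> \<le> L * \<bar>g x - g y\<bar>"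
        using L g(3) unfolding bilip_bound_def by metis+
      then show "1 / L * \<bar>x - y\<bar> \<le> \<bar>g x - g y\<bar>" "\<bar>g x - g y\<bar> \<le> L * \<bar>x - y\<bar>"
        using L1 by (auto simp: field_simps)
    qed
    moreover obtain C where "\<And>x. \<bar>f x - x\<bar> \<le> C"
      using f by (auto simp: bilip_bd_group_def bounded_displacement_def bdd_above_def)
    then have "\<bar>g x - x\<bar> \<le> C" for x
      using g(3)[of x] by (metis abs_minus_commute)
    then have "bounded_displacement g"
      unfolding bounded_displacement_def by (intro bdd_aboveI) auto
    ultimately show ?thesis using g(1) by (auto simp: bilip_bd_group_def)
  qed
  ultimately show "inv\<^bsub>homeo_plus\<^esub> f \<in> carrier bilip_bd_group" by simp
next
  fix f g assume f: "f \<in> carrier bilip_bd_group" and g: "g \<in> carrier bilip_bd_group"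
  obtain L M where L: "bilip_bound f L" and M: "bilip_bound g M"
    using f g by (auto simp: bilip_bd_group_def)
  have "bilip_bound (f \<circ> g) (L * M)"
    unfolding bilip_bound_def
  proof (intro conjI allI)
    have L1: "1 \<le> L" "1 \<le> M" using L M by (simp_all add: bilip_bound_def)
    show "1 \<le> L * M" using mult_mono[of 1 L 1 M] L1 by simp
    fix x y
    have a: "1 / L * \<bar>g x - g y\<bar> \<le> \<bar>f (g x) - f (g y)\<bar>" "\<bar>f (g x) - f (g y)\<bar> \<le> L * \<bar>g x - g y\<bar>"
      and b: "1 / M * \<bar>x - y\<bar> \<le> \<bar>g x - g y\<bar>" "\<bar>g x - g y\<bar> \<le> M * \<bar>x - y\<bar>"
      using L M by (simp_all add: bilip_bound_def)
    have "1 / (L * M) * \<bar>x - y\<bar> = 1 / L * (1 / M * \<bar>x - y\<bar>)" by simp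
    also have "\<dots> \<le> 1 / L * \<bar>g x - g y\<bar>"
      using b(1) L1 by (intro mult_left_mono) auto
    finally show "1 / (L * M) * \<bar>x - y\<bar> \<le> \<bar>(f \<circ> g) x - (f \<circ> g) y\<bar>" using a(1) by simp
    have "L * \<bar>g x - g y\<bar> \<le> L * (M * \<bar>x - y\<bar>)"
      using b(2) L1 by (intro mult_left_mono) auto
    then show "\<bar>(f \<circ> g) x - (f \<circ> g) y\<bar> \<le> L * M * \<bar>x - y\<bar>" using a(2) by (simp add: mult.assoc)
  qed
  moreover obtain C D where CD: "\<And>x. \<bar>f x - x\<bar> \<le> C" "\<And>x. \<bar>g x - x\<bar> \<le> D"
    using f g by (auto simp: bilip_bd_group_def bounded_displacement_def bdd_above_def)
  have "\<bar>(f \<circ> g) x - x\<bar> \<le> C + D" for x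
    using CD(1)[of "g x"] CD(2)[of x] by simp
  then have "bounded_displacement (f \<circ> g)"
    unfolding bounded_displacement_def by (intro bdd_aboveI) auto
  moreover have "f \<circ> g \<in> carrier homeo_plus"
    using monoid.m_closed[OF group.is_monoid[OF group_homeo_plus], of f g] f g
    by (auto simp: bilip_bd_group_def homeo_plus_def)
  ultimately show "f \<otimes>\<^bsub>homeo_plus\<^esub> g \<in> carrier bilip_bd_group"
    by (auto simp: bilip_bd_group_def homeo_plus_def)
qed

theorem group_bilip_bd: "group bilip_bd_group"
  using group.subgroup_imp_group[OF group_homeo_plus subgroup_bilip_bd]
  by (simp add: bilip_bd_group_def)


section \<open>Independence of the type underlying the Hilbert spaces\<close>

lemma complex_field_simps [simp]:
  "carrier complex_field = UNIV" "mult complex_field = (*)" "one complex_field = 1"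
  "zero complex_field = 0" "add complex_field = (+)"
  by (simp_all add: complex_field_def)

context complex_hilbert_space
begin

lemma cinner_add_right:
  assumes "x \<in> carrier H" "y \<in> carrier H" "z \<in> carrier H"
  shows "cinner H z (x \<oplus> y) = cinner H z x + cinner H z y"
proof -
  have "cinner H z (x \<oplus> y) = cnj (cinner H (x \<oplus> y) z)"
    using assms by (intro cinner_commute) auto
  then show ?thesis
    using assms by (simp add: cinner_add_left cinner_commute[symmetric])
qed

lemma cinner_smult_right:
  assumes "x \<in> carrier H" "y \<in> carrier H"
  shows "cinner H x (a \<odot> y) = cnj a * cinner H x y"
proof -
  have "cinner H x (a \<odot> y) = cnj (cinner H (a \<odot> y) x)"
    using assms by (intro cinner_commute) (auto intro: smult_closed)
  then show ?thesis
    using assms by (simp add: cinner_smult_left cinner_commute[symmetric])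
qed

lemma smult_in [simp, intro]: "x \<in> carrier H \<Longrightarrow> a \<odot> x \<in> carrier H"
  by (rule smult_closed) auto

lemma smult_neg1: "x \<in> carrier H \<Longrightarrow> (-1) \<odot> x = \<ominus> x"
proof -
  assume x: "x \<in> carrier H"
  have "(-1) \<odot> x \<oplus> x = ((-1) + 1) \<odot> x"
    using smult_l_distr[of "-1" 1 x] smult_one[of x] x by simp
  also have "\<dots> = \<zero>" using smult_l_null[of x] x by simp
  finally show ?thesis using x by (metis M.minus_equality smult_in)
qed

lemma cinner_minus_left:
  "x \<in> carrier H \<Longrightarrow> y \<in> carrier H \<Longrightarrow> cinner H (\<ominus> x) y = - cinner H x y"
  by (simp add: smult_neg1[symmetric] cinner_smult_left)

lemma cinner_diff_left:
  "x \<in> carrier H \<Longrightarrow> y \<in> carrier H \<Longrightarrow> z \<in> carrier H \<Longrightarrow>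
     cinner H (x \<ominus> y) z = cinner H x z - cinner H y z"
  by (simp add: a_minus_def cinner_add_left cinner_minus_left)

lemma cinner_zero_left [simp]: "y \<in> carrier H \<Longrightarrow> cinner H \<zero> y = 0"
  using cinner_add_left[of \<zero> \<zero> y] by simp

lemma cinner_zero_right [simp]: "y \<in> carrier H \<Longrightarrow> cinner H y \<zero> = 0"
  using cinner_commute[of \<zero> y] by simp

lemma cinner_self: "x \<in> carrier H \<Longrightarrow> cinner H x x = of_real (Re (cinner H x x))"
  using cinner_commute[of x x] by (simp add: complex_eq_iff)

lemma cinner_ge0 [simp]: "x \<in> carrier H \<Longrightarrow> 0 \<le> Re (cinner H x x)"
  by (cases "x = \<zero>") (auto dest: cinner_pos simp: less_imp_le)

lemma hnorm_ge0 [simp]: "x \<in> carrier H \<Longrightarrow> 0 \<le> hnorm H x"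
  by (simp add: hnorm_def)

lemma hnorm_eq0: "x \<in> carrier H \<Longrightarrow> hnorm H x = 0 \<longleftrightarrow> x = \<zero>"
  by (cases "x = \<zero>") (use cinner_pos[of x] in \<open>auto simp: hnorm_def\<close>)

lemma cinner_eq0_imp: "x \<in> carrier H \<Longrightarrow> cinner H x x = 0 \<Longrightarrow> x = \<zero>"
  using cinner_pos[of x] by auto

lemma hnorm_sq: "x \<in> carrier H \<Longrightarrow> (hnorm H x)\<^sup>2 = Re (cinner H x x)"
  by (simp add: hnorm_def)

lemma cauchy_schwarz:
  assumes x: "x \<in> carrier H" and y: "y \<in> carrier H"
  shows "cmod (cinner H x y) \<le> hnorm H x * hnorm H y"
proof (cases "y = \<zero>")
  case True
  then show ?thesis using x y by simp
next
  case False
  define n where "n = Re (cinner H y y)"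
  define c where "c = cinner H x y"
  have n: "n > 0" using False y cinner_pos unfolding n_def by blast
  define a where "a = - (c / of_real n)"
  define z where "z = x \<oplus> a \<odot> y"
  have z: "z \<in> carrier H" using x y by (simp add: z_def)
  have yy: "cinner H y y = of_real n" using cinner_self[OF y] by (simp add: n_def)
  have yx: "cinner H y x = cnj c" using cinner_commute[OF x y] by (simp add: c_def)
  have "cinner H z z = cinner H x x + cnj a * c + a * (cnj c + cnj a * of_real n)"
    using x y by (simp add: z_def cinner_add_left cinner_add_right cinner_smult_left
        cinner_smult_right yy yx c_def[symmetric] algebra_simps)
  also have "cnj c + cnj a * of_real n = 0" using n by (simp add: a_def)
  also have "cnj a * c = - of_real ((cmod c)\<^sup>2 / n)"
    by (simp only: a_def complex_norm_square of_real_divide) (simp add: mult.commute)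
  finally have "Re (cinner H z z) = Re (cinner H x x) - (cmod c)\<^sup>2 / n" by simp
  then have "(cmod c)\<^sup>2 / n \<le> Re (cinner H x x)" using cinner_ge0[OF z] by simp
  then have "(cmod c)\<^sup>2 \<le> Re (cinner H x x) * n" using n by (simp add: field_simps)
  then have "(cmod c)\<^sup>2 \<le> (hnorm H x * hnorm H y)\<^sup>2"
    using x y by (simp add: power_mult_distrib hnorm_sq n_def)
  then show ?thesis unfolding c_def by (rule power2_le_imp_le) (use x y in simp)
qed

definition closed_subspace :: "'h set \<Rightarrow> bool" where
  "closed_subspace K \<longleftrightarrow>
     K \<subseteq> carrier H \<and> \<zero> \<in> K \<and> (\<forall>x\<in>K. \<forall>y\<in>K. x \<oplus> y \<in> K) \<and> (\<forall>a. \<forall>x\<in>K. a \<odot> x \<in> K) \<and>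
     (\<forall>\<sigma> x. range \<sigma> \<subseteq> K \<and> x \<in> carrier H \<and> (\<lambda>n. hdist H (\<sigma> n) x) \<longlonglongrightarrow> 0 \<longrightarrow> x \<in> K)"

definition annihilator :: "'h set \<Rightarrow> 'h set" where
  "annihilator W = {v \<in> carrier H. \<forall>w\<in>W. cinner H v w = 0}"

lemma closed_subspace_annihilator:
  assumes W: "W \<subseteq> carrier H"
  shows "closed_subspace (annihilator W)"
  unfolding closed_subspace_def
proof (intro conjI allI impI ballI)
  fix \<sigma> x assume *: "range \<sigma> \<subseteq> annihilator W \<and> x \<in> carrier H \<and> (\<lambda>n. hdist H (\<sigma> n) x) \<longlonglongrightarrow> 0"
  have "cinner H x w = 0" if w: "w \<in> W" for w
  proof -
    have wH: "w \<in> carrier H" using w W by auto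
    have "cmod (cinner H x w) \<le> hdist H (\<sigma> n) x * hnorm H w" for n
    proof -
      have s: "\<sigma> n \<in> carrier H" "cinner H (\<sigma> n) w = 0"
        using * w by (auto simp: annihilator_def image_subset_iff)
      have "cinner H (\<sigma> n \<ominus> x) w = - cinner H x w"
        using s * wH by (simp add: cinner_diff_left)
      then show ?thesis
        using cauchy_schwarz[of "\<sigma> n \<ominus> x" w] s * wH by (simp add: hdist_def)
    qed
    moreover have "(\<lambda>n. hdist H (\<sigma> n) x * hnorm H w) \<longlonglongrightarrow> 0"
      using * tendsto_mult_right[of _ 0 sequentially "hnorm H w"] by simp
    ultimately have "cmod (cinner H x w) \<le> 0"
      by (meson LIMSEQ_le_const)
    then show ?thesis by simp
  qed
  then show "x \<in> annihilator W" using * by (simp add: annihilator_def)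
qed (use W in \<open>auto simp: annihilator_def cinner_add_left cinner_smult_left subset_iff\<close>)

end

definition transport_space ::
  "('h, 'b) inner_space_scheme \<Rightarrow> 'h set \<Rightarrow> ('h \<Rightarrow> 'k) \<Rightarrow> 'k inner_space" where
  "transport_space H K T =
     \<lparr>carrier = T ` K, mult = (\<lambda>x y. x), one = T \<zero>\<^bsub>H\<^esub>, zero = T \<zero>\<^bsub>H\<^esub>,
      add = (\<lambda>x y. T (inv_into K T x \<oplus>\<^bsub>H\<^esub> inv_into K T y)),
      smult = (\<lambda>a x. T (a \<odot>\<^bsub>H\<^esub> inv_into K T x)),
      cinner = (\<lambda>x y. cinner H (inv_into K T x) (inv_into K T y))\<rparr>"

lemma transport_space_simps [simp]:
  "carrier (transport_space H K T) = T ` K"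
  "zero (transport_space H K T) = T \<zero>\<^bsub>H\<^esub>"
  by (simp_all add: transport_space_def)

lemma transport_space_ops:
  assumes "inj_on T K" "x \<in> K" "y \<in> K"
  shows "T x \<oplus>\<^bsub>transport_space H K T\<^esub> T y = T (x \<oplus>\<^bsub>H\<^esub> y)"
    and "a \<odot>\<^bsub>transport_space H K T\<^esub> T x = T (a \<odot>\<^bsub>H\<^esub> x)"
    and "cinner (transport_space H K T) (T x) (T y) = cinner H x y"
  using assms by (simp_all add: transport_space_def)

lemma cring_complex_field: "cring complex_field"
proof (rule cringI)
  show "abelian_group complex_field"
    by (rule abelian_groupI) (auto intro: exI[of _ "- x" for x] simp: add_eq_0_iff)
  show "comm_monoid complex_field"
    by (rule comm_monoidI) auto
qed (auto simp: algebra_simps)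

lemma (in complex_hilbert_space) transport_space:
  assumes K: "closed_subspace K" and inj: "inj_on T K"
  shows "complex_hilbert_space (transport_space H K T)"
    and "\<lbrakk>x \<in> K; y \<in> K\<rbrakk> \<Longrightarrow> T x \<ominus>\<^bsub>transport_space H K T\<^esub> T y = T (x \<ominus> y)"
    and "x \<in> K \<Longrightarrow> hnorm (transport_space H K T) (T x) = hnorm H x"
    and "\<lbrakk>x \<in> K; y \<in> K\<rbrakk> \<Longrightarrow> x \<ominus> y \<in> K"
proof -
  let ?H = "transport_space H K T"
  have KH: "\<And>x. x \<in> K \<Longrightarrow> x \<in> carrier H" and K0: "\<zero> \<in> K"
    and Kadd: "\<And>x y. x \<in> K \<Longrightarrow> y \<in> K \<Longrightarrow> x \<oplus> y \<in> K"
    and Ksm: "\<And>a x. x \<in> K \<Longrightarrow> a \<odot> x \<in> K"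
    and Kcl: "\<And>\<sigma> x. range \<sigma> \<subseteq> K \<Longrightarrow> x \<in> carrier H \<Longrightarrow> (\<lambda>n. hdist H (\<sigma> n) x) \<longlonglongrightarrow> 0 \<Longrightarrow> x \<in> K"
    using K unfolding closed_subspace_def by blast+
  note ops = transport_space_ops[OF inj, where H = H]
  have Kneg: "\<ominus> x \<in> K" if "x \<in> K" for x
    using Ksm[OF that, of "-1"] smult_neg1[OF KH[OF that]] by simp
  have ab: "abelian_group ?H"
  proof (rule abelian_groupI)
    fix x assume "x \<in> carrier ?H"
    then obtain u where u: "x = T u" "u \<in> K" by auto
    then have "T (\<ominus> u) \<oplus>\<^bsub>?H\<^esub> x = \<zero>\<^bsub>?H\<^esub>"
      using ops(1)[OF Kneg[OF u(2)] u(2)] KH by (simp add: M.l_neg)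
    then show "\<exists>y\<in>carrier ?H. y \<oplus>\<^bsub>?H\<^esub> x = \<zero>\<^bsub>?H\<^esub>"
      using Kneg[OF u(2)] by auto
  qed (use K0 in \<open>auto simp: ops Kadd KH M.a_assoc M.a_comm M.a_lcomm\<close>)
  interpret A: abelian_group ?H by (rule ab)
  show minus: "T x \<ominus>\<^bsub>?H\<^esub> T y = T (x \<ominus> y)" if "x \<in> K" "y \<in> K" for x y
  proof -
    have "T (\<ominus> y) \<oplus>\<^bsub>?H\<^esub> T y = \<zero>\<^bsub>?H\<^esub>"
      using ops(1)[OF Kneg[OF that(2)] that(2)] KH that by (simp add: M.l_neg)
    then have "\<ominus>\<^bsub>?H\<^esub> T y = T (\<ominus> y)"
      using Kneg[OF that(2)] that by (intro A.minus_equality) auto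
    then show ?thesis
      using ops(1)[OF that(1) Kneg[OF that(2)]] by (simp add: a_minus_def)
  qed
  show nrm: "hnorm ?H (T x) = hnorm H x" if "x \<in> K" for x
    using ops(3)[OF that that] by (simp add: hnorm_def)
  show Kdiff: "x \<ominus> y \<in> K" if "x \<in> K" "y \<in> K" for x y
    using that by (simp add: a_minus_def Kadd Kneg)
  have dist: "hdist ?H (T x) (T y) = hdist H x y" if "x \<in> K" "y \<in> K" for x y
    using that by (simp add: hdist_def minus nrm Kdiff)
  have modl: "module complex_field ?H"
    by (rule moduleI[OF cring_complex_field ab])
      (auto simp: ops Ksm Kadd KH smult_r_distr smult_assoc1[simplified]
        smult_l_distr[simplified] smult_one[simplified])
  show "complex_hilbert_space ?H"
  proof (intro complex_hilbert_space.intro complex_hilbert_space_axioms.intro)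
    fix \<sigma> :: "nat \<Rightarrow> _" assume s: "range \<sigma> \<subseteq> carrier ?H"
      and C: "\<forall>e>0. \<exists>N. \<forall>m\<ge>N. \<forall>n\<ge>N. hdist ?H (\<sigma> m) (\<sigma> n) < e"
    define \<tau> where "\<tau> = (\<lambda>n::nat. inv_into K T (\<sigma> n))"
    have tK: "\<tau> n \<in> K" and sT: "\<sigma> n = T (\<tau> n)" for n
      using s by (auto simp: \<tau>_def image_subset_iff inv_into_into f_inv_into_f)
    have dist': "hdist ?H (\<sigma> m) (\<sigma> n) = hdist H (\<tau> m) (\<tau> n)" for m n
      unfolding sT by (rule dist[OF tK tK])
    have "\<exists>x\<in>carrier H. (\<lambda>n. hdist H (\<tau> n) x) \<longlonglongrightarrow> 0"
    proof (rule complete)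
      show "range \<tau> \<subseteq> carrier H" using tK KH by blast
      show "\<forall>e>0. \<exists>N. \<forall>m\<ge>N. \<forall>n\<ge>N. hdist H (\<tau> m) (\<tau> n) < e"
        using C unfolding dist' .
    qed
    then obtain x where x: "x \<in> carrier H" "(\<lambda>n. hdist H (\<tau> n) x) \<longlonglongrightarrow> 0" by auto
    have xK: "x \<in> K" by (rule Kcl[OF _ x]) (use tK in blast)
    have "(\<lambda>n. hdist ?H (\<sigma> n) (T x)) \<longlonglongrightarrow> 0"
      unfolding sT dist[OF tK xK] by (rule x(2))
    then show "\<exists>x\<in>carrier ?H. (\<lambda>n. hdist ?H (\<sigma> n) x) \<longlonglongrightarrow> 0"
      using xK by (intro bexI[of _ "T x"]) simp_all
  next
    fix x assume "x \<in> carrier ?H" "x \<noteq> \<zero>\<^bsub>?H\<^esub>"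
    then show "0 < Re (cinner ?H x x)"
      using KH by (auto simp: ops intro!: cinner_pos)
  next
    fix x y assume "x \<in> carrier ?H" "y \<in> carrier ?H"
    then obtain u v where uv: "x = T u" "y = T v" "u \<in> K" "v \<in> K" by auto
    show "cinner ?H y x = cnj (cinner ?H x y)"
      unfolding uv ops(3)[OF uv(3,4)] ops(3)[OF uv(4,3)]
      by (rule cinner_commute[OF KH[OF uv(3)] KH[OF uv(4)]])
  qed (use modl in \<open>auto simp: ops Ksm Kadd KH cinner_add_left cinner_smult_left\<close>)
qed

lemma unitary_groupD:
  assumes "U \<in> carrier (unitary_group H)"
  shows "bij_betw U (carrier H) (carrier H)"
    and "x \<in> carrier H \<Longrightarrow> U x \<in> carrier H"
    and "\<lbrakk>x \<in> carrier H; y \<in> carrier H\<rbrakk> \<Longrightarrow> U (x \<oplus>\<^bsub>H\<^esub> y) = U x \<oplus>\<^bsub>H\<^esub> U y"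
    and "x \<in> carrier H \<Longrightarrow> U (a \<odot>\<^bsub>H\<^esub> x) = a \<odot>\<^bsub>H\<^esub> U x"
    and "\<lbrakk>x \<in> carrier H; y \<in> carrier H\<rbrakk> \<Longrightarrow> cinner H (U x) (U y) = cinner H x y"
  using assms by (auto simp: unitary_group_def Bij_def bij_betw_def)

lemma unitary_group_mult:
  assumes "U \<in> carrier (unitary_group H)" "V \<in> carrier (unitary_group H)"
  shows "U \<otimes>\<^bsub>unitary_group H\<^esub> V = compose (carrier H) U V"
  using assms by (simp add: unitary_group_def BijGroup_def)

theorem kazhdan_pair_all_types:
  fixes H :: "('h, 'b) inner_space_scheme" and G :: "('g, 'c) monoid_scheme"
  assumes G: "group G" and \<Gamma>: "\<Gamma> \<subseteq> carrier G" and S: "S \<subseteq> carrier G"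
    and kaz: "kazhdan_pair G \<Gamma> S \<epsilon>"
    and H: "complex_hilbert_space H" and \<pi>: "\<pi> \<in> hom G (unitary_group H)"
    and noinv: "no_invariant_vectors H \<pi> \<Gamma>" and \<xi>: "\<xi> \<in> carrier H"
  shows "max_displacement H \<pi> S \<xi> \<ge> \<epsilon> * hnorm H \<xi>"
proof -
  interpret G: group G by (rule G)
  interpret H: complex_hilbert_space H by (rule H)
  have U: "\<pi> g \<in> carrier (unitary_group H)" if "g \<in> carrier G" for g
    using hom_in_carrier[OF \<pi> that] .
  note D = unitary_groupD[OF U]
  have pi_mult: "\<pi> (g \<otimes>\<^bsub>G\<^esub> h) v = \<pi> g (\<pi> h v)"
    if "g \<in> carrier G" "h \<in> carrier G" "v \<in> carrier H" for g h v
    using hom_mult[OF \<pi> that(1,2)] unitary_group_mult[OF U[OF that(1)] U[OF that(2)]] that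
    by (simp add: compose_eq)
  have pi_one: "\<pi> \<one>\<^bsub>G\<^esub> v = v" if v: "v \<in> carrier H" for v
  proof -
    have "\<pi> \<one>\<^bsub>G\<^esub> (\<pi> \<one>\<^bsub>G\<^esub> v) = \<pi> \<one>\<^bsub>G\<^esub> v"
      using pi_mult[of "\<one>\<^bsub>G\<^esub>" "\<one>\<^bsub>G\<^esub>" v] v by simp
    then show ?thesis
      using D(1)[of "\<one>\<^bsub>G\<^esub>"] D(2)[of "\<one>\<^bsub>G\<^esub>" v] v unfolding bij_betw_def
      by (metis G.one_closed inj_onD)
  qed
  have pi_inv: "\<pi> g (\<pi> (inv\<^bsub>G\<^esub> g) v) = v" "\<pi> (inv\<^bsub>G\<^esub> g) (\<pi> g v) = v"
    if "g \<in> carrier G" "v \<in> carrier H" for g v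
    using that pi_mult[of g "inv\<^bsub>G\<^esub> g" v] pi_mult[of "inv\<^bsub>G\<^esub> g" g v] pi_one by simp_all
  have adj: "cinner H (\<pi> g v) w = cinner H v (\<pi> (inv\<^bsub>G\<^esub> g) w)"
    if "g \<in> carrier G" "v \<in> carrier H" "w \<in> carrier H" for g v w
    using D(5)[of g v "\<pi> (inv\<^bsub>G\<^esub> g) w"] D(2)[of "inv\<^bsub>G\<^esub> g" w] pi_inv(1)[of g w] that by simp

  define orb where "orb = (\<lambda>g. \<pi> g \<xi>) ` carrier G"
  define K where "K = H.annihilator (H.annihilator orb)"
  have orbH: "orb \<subseteq> carrier H" using D(2) \<xi> by (auto simp: orb_def)
  have annH: "H.annihilator W \<subseteq> carrier H" for W by (auto simp: H.annihilator_def)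
  have ann_inv: "\<pi> g v \<in> H.annihilator W"
    if W: "W \<subseteq> carrier H" "\<And>h w. h \<in> carrier G \<Longrightarrow> w \<in> W \<Longrightarrow> \<pi> h w \<in> W"
      and g: "g \<in> carrier G" and v: "v \<in> H.annihilator W" for g v W
  proof -
    have "cinner H (\<pi> g v) w = 0" if w: "w \<in> W" for w
      using adj[of g v w] W(1) W(2)[of "inv\<^bsub>G\<^esub> g" w] w g v
      by (auto simp: H.annihilator_def)
    then show ?thesis using D(2)[OF g] v by (auto simp: H.annihilator_def)
  qed
  have orb_inv: "\<pi> h w \<in> orb" if hw: "h \<in> carrier G" "w \<in> orb" for h w
  proof -
    obtain g where g: "g \<in> carrier G" "w = \<pi> g \<xi>" using hw(2) by (auto simp: orb_def)
    then have "\<pi> h w = \<pi> (h \<otimes>\<^bsub>G\<^esub> g) \<xi>" using pi_mult[OF hw(1) g(1) \<xi>] by simp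
    moreover have "h \<otimes>\<^bsub>G\<^esub> g \<in> carrier G" using hw(1) g(1) by simp
    ultimately show ?thesis unfolding orb_def by (rule image_eqI)
  qed
  have K_inv: "\<pi> g v \<in> K" if "g \<in> carrier G" "v \<in> K" for g v
    unfolding K_def
    by (rule ann_inv[OF annH ann_inv[OF orbH orb_inv] that(1) that(2)[unfolded K_def]])
  have Kcs: "H.closed_subspace K" unfolding K_def by (rule H.closed_subspace_annihilator[OF annH])
  have KH: "v \<in> carrier H" if "v \<in> K" for v using that annH by (auto simp: K_def)
  have "\<xi> \<in> orb" using pi_one[OF \<xi>] by (auto simp: orb_def intro!: image_eqI[of _ _ "\<one>\<^bsub>G\<^esub>"])
  then have "cinner H \<xi> w = 0" if "w \<in> H.annihilator orb" for w
    using that \<xi> H.cinner_commute[of w \<xi>] by (auto simp: H.annihilator_def)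
  then have \<xi>K: "\<xi> \<in> K"
    using \<xi> by (simp add: K_def H.annihilator_def)

  define T where "T = (\<lambda>v g. if g \<in> carrier G then cinner H v (\<pi> g \<xi>) else 0)"
  have inj: "inj_on T K"
  proof (rule inj_onI)
    fix u v assume u: "u \<in> K" and v: "v \<in> K" and eq: "T u = T v"
    define d where "d = u \<ominus>\<^bsub>H\<^esub> v"
    have uv: "u \<in> carrier H" "v \<in> carrier H" using u v KH by auto
    have d: "d \<in> carrier H" using uv by (simp add: d_def)
    have "cinner H u (\<pi> g \<xi>) = cinner H v (\<pi> g \<xi>)" if "g \<in> carrier G" for g
      using fun_cong[OF eq, of g] that by (simp add: T_def)
    then have "cinner H u w = cinner H v w" if "w \<in> orb" for w
      using that by (auto simp: orb_def)
    then have dann: "d \<in> H.annihilator orb"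
      using uv d orbH by (auto simp: H.annihilator_def d_def H.cinner_diff_left subset_iff)
    then have "cinner H u d = 0" "cinner H v d = 0"
      using u v by (auto simp: K_def H.annihilator_def)
    then have "cinner H d d = 0"
      using H.cinner_diff_left[OF uv d] by (simp add: d_def[symmetric])
    then have "d = \<zero>\<^bsub>H\<^esub>" using d H.cinner_eq0_imp by blast
    then have "\<ominus>\<^bsub>H\<^esub> (\<ominus>\<^bsub>H\<^esub> v) = u"
      using uv by (intro H.M.minus_equality) (simp_all add: d_def a_minus_def)
    then show "u = v" using uv by simp
  qed

  define H' where "H' = transport_space H K T"
  define \<rho> where "\<rho> = (\<lambda>g. \<lambda>x\<in>T ` K. T (\<pi> g (inv_into K T x)))"
  note tr = H.transport_space[OF Kcs inj, folded H'_def]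
  note ops = transport_space_ops[OF inj, where H = H, folded H'_def]
  have cH': "carrier H' = T ` K" and zH': "\<zero>\<^bsub>H'\<^esub> = T \<zero>\<^bsub>H\<^esub>" by (simp_all add: H'_def)
  have Kadd: "x \<oplus>\<^bsub>H\<^esub> y \<in> K" if "x \<in> K" "y \<in> K" for x y
    using Kcs that unfolding H.closed_subspace_def by blast
  have Ksm: "a \<odot>\<^bsub>H\<^esub> x \<in> K" if "x \<in> K" for x a
    using Kcs that unfolding H.closed_subspace_def by blast
  have \<rho>: "\<rho> g (T v) = T (\<pi> g v)" if "v \<in> K" for g v
    using that inj by (simp add: \<rho>_def)
  have \<rho>U: "\<rho> g \<in> carrier (unitary_group H')" if g: "g \<in> carrier G" for g
  proof -
    have "bij_betw (\<rho> g) (T ` K) (T ` K)"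
      by (rule bij_betw_byWitness[where f' = "\<rho> (inv\<^bsub>G\<^esub> g)"])
        (use g K_inv KH pi_inv in \<open>auto simp: \<rho>\<close>)
    then have "\<rho> g \<in> Bij (carrier H')" by (simp add: Bij_def cH' \<rho>_def)
    then show ?thesis
      using g D by (auto simp: unitary_group_def cH' ops \<rho> Kadd Ksm K_inv KH)
  qed
  have "\<rho> \<in> hom G (unitary_group H')"
  proof (rule homI)
    fix g h assume gh: "g \<in> carrier G" "h \<in> carrier G"
    have "\<rho> (g \<otimes>\<^bsub>G\<^esub> h) = compose (T ` K) (\<rho> g) (\<rho> h)"
    proof
      fix x show "\<rho> (g \<otimes>\<^bsub>G\<^esub> h) x = compose (T ` K) (\<rho> g) (\<rho> h) x"
      proof (cases "x \<in> T ` K")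
        case True
        then show ?thesis using gh pi_mult K_inv KH by (auto simp: \<rho> compose_eq)
      next
        case False
        then show ?thesis by (simp add: compose_def \<rho>_def)
      qed
    qed
    then show "\<rho> (g \<otimes>\<^bsub>G\<^esub> h) = \<rho> g \<otimes>\<^bsub>unitary_group H'\<^esub> \<rho> h"
      using unitary_group_mult[OF \<rho>U[OF gh(1)] \<rho>U[OF gh(2)]] by (simp add: cH')
  qed (rule \<rho>U)
  moreover have "no_invariant_vectors H' \<rho> \<Gamma>"
    unfolding no_invariant_vectors_def
  proof (intro ballI impI)
    fix x assume x: "x \<in> carrier H'" and fixd: "\<forall>g\<in>\<Gamma>. \<rho> g x = x"
    obtain v where v: "x = T v" "v \<in> K" using x by (auto simp: cH')
    have "\<pi> g v = v" if "g \<in> \<Gamma>" for g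
    proof (rule inj_onD[OF inj])
      show "T (\<pi> g v) = T v" using fixd that \<rho>[OF v(2), of g] v(1) by simp
      show "\<pi> g v \<in> K" using that \<Gamma> K_inv v(2) by blast
    qed (rule v(2))
    then have "v = \<zero>\<^bsub>H\<^esub>" using noinv v KH by (auto simp: no_invariant_vectors_def)
    then show "x = \<zero>\<^bsub>H'\<^esub>" using v by (simp add: zH')
  qed
  ultimately have "max_displacement H' \<rho> S (T \<xi>) \<ge> \<epsilon> * hnorm H' (T \<xi>)"
    using kaz tr(1) \<xi>K unfolding kazhdan_pair_def by (auto simp: cH')
  moreover have "hnorm H' (\<rho> g (T \<xi>) \<ominus>\<^bsub>H'\<^esub> T \<xi>) = hnorm H (\<pi> g \<xi> \<ominus>\<^bsub>H\<^esub> \<xi>)" if "g \<in> S" for g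
    using that S \<xi>K K_inv[of g \<xi>] by (auto simp: \<rho> tr)
  then have "(\<lambda>g. hnorm H' (\<rho> g (T \<xi>) \<ominus>\<^bsub>H'\<^esub> T \<xi>)) ` S = (\<lambda>g. hnorm H (\<pi> g \<xi> \<ominus>\<^bsub>H\<^esub> \<xi>)) ` S"
    by (rule image_cong[OF refl])
  then have "max_displacement H' \<rho> S (T \<xi>) = max_displacement H \<pi> S \<xi>"
    by (simp add: max_displacement_def)
  ultimately show ?thesis using \<xi>K by (simp add: tr)
qed

end

theory Submission
  imports Defs "HOL-Probability.Distribution_Functions"
begin

text \<open>Let \<open>G\<close> act on \<open>L\<^sup>2(\<real>)\<close> by \<open>\<pi>(g)f = (d(g\<^sub>*\<lambda>)/d\<lambda>)\<^bsup>1/2\<^esup> (f \<circ> g\<^bsup>-1\<^esup>)\<close>, where \<open>\<lambda>\<close> is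
  Lebesgue measure. A nonzero \<open>\<Gamma>\<close>-invariant vector \<open>f\<close> would give the finite \<open>\<Gamma>\<close>-invariant
  measure \<open>|f|\<^sup>2 d\<lambda>\<close>, whose lower median would be a global fixed point; so every Kazhdan pair
  \<open>(S, \<epsilon>)\<close> can be tested on the indicators of \<open>[-r, r]\<close>. Let \<open>M\<close> be the largest bi-Lipschitz
  constant on \<open>S\<close>. The density \<open>D\<close> of \<open>g\<^sub>*\<lambda>\<close> takes values in \<open>[1/M, M]\<close> and, because
  displacements are bounded, has mean close to \<open>1\<close> on long intervals. The square root lies above
  its chord in the sense that \<open>sqrt D \<ge> sqrt M / (M + 1) * (D + 1)\<close>, so letting \<open>r\<close> tend to
  infinity yields \<open>\<epsilon>\<^sup>2 \<le> 2 - 4 * sqrt M / (M + 1)\<close>. Both lower bounds on \<open>M\<close> follow from this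
  inequality, as \<open>(x - 1) / (x + 1) \<le> ln x / 2\<close> for \<open>x = sqrt M\<close> and \<open>2 * M \<ge> M + 1\<close>.\<close>

section \<open>The Hilbert space of square-integrable functions\<close>

definition L2 :: "'a measure \<Rightarrow> ('a \<Rightarrow> complex) set" where
  "L2 M = {f \<in> borel_measurable M. integrable M (\<lambda>x. (cmod (f x))\<^sup>2)}"

text \<open>Vectors of \<open>L2_space M\<close> are chosen representatives of almost-everywhere classes.\<close>

definition L2_rep :: "'a measure \<Rightarrow> ('a \<Rightarrow> complex) \<Rightarrow> 'a \<Rightarrow> complex" where
  "L2_rep M f = (SOME g. g \<in> L2 M \<and> (AE x in M. g x = f x))"

definition L2_space :: "'a measure \<Rightarrow> ('a \<Rightarrow> complex) inner_space" where
  "L2_space M =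
     \<lparr>carrier = L2_rep M ` L2 M, mult = (\<lambda>f g. f), one = L2_rep M (\<lambda>x. 0),
      zero = L2_rep M (\<lambda>x. 0), add = (\<lambda>f g. L2_rep M (\<lambda>x. f x + g x)),
      smult = (\<lambda>a f. L2_rep M (\<lambda>x. a * f x)),
      cinner = (\<lambda>f g. LINT x|M. f x * cnj (g x))\<rparr>"

lemma borel_measurable_cnj [measurable (raw)]:
  assumes "f \<in> borel_measurable M"
  shows "(\<lambda>x. cnj (f x)) \<in> borel_measurable M"
  using measurable_compose[OF assms borel_measurable_continuous_onI[OF continuous_on_cnj[OF continuous_on_id]]]
  by simp

lemma L2_measurable [measurable_dest]: "f \<in> L2 M \<Longrightarrow> f \<in> borel_measurable M"
  by (simp add: L2_def)

lemma L2_integrable: "f \<in> L2 M \<Longrightarrow> integrable M (\<lambda>x. (cmod (f x))\<^sup>2)"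
  by (simp add: L2_def)

lemma L2_zero [simp]: "(\<lambda>x. 0) \<in> L2 M"
  by (simp add: L2_def)

lemma L2_scale:
  assumes "f \<in> L2 M"
  shows "(\<lambda>x. a * f x) \<in> L2 M"
  using assms by (auto simp: L2_def norm_mult power_mult_distrib)

lemma L2_add:
  assumes f: "f \<in> L2 M" and g: "g \<in> L2 M"
  shows "(\<lambda>x. f x + g x) \<in> L2 M"
proof -
  have [measurable]: "f \<in> borel_measurable M" "g \<in> borel_measurable M"
    using f g by (simp_all add: L2_def)
  have "integrable M (\<lambda>x. (cmod (f x + g x))\<^sup>2)"
  proof (rule Bochner_Integration.integrable_bound)
    show "integrable M (\<lambda>x. 2 * (cmod (f x))\<^sup>2 + 2 * (cmod (g x))\<^sup>2)"
      using f g by (simp add: L2_def)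
    have "(cmod (f x + g x))\<^sup>2 \<le> 2 * (cmod (f x))\<^sup>2 + 2 * (cmod (g x))\<^sup>2" for x
    proof -
      have "(cmod (f x + g x))\<^sup>2 \<le> (cmod (f x) + cmod (g x))\<^sup>2"
        by (intro power_mono norm_triangle_ineq) auto
      also have "\<dots> \<le> 2 * (cmod (f x))\<^sup>2 + 2 * (cmod (g x))\<^sup>2"
        using sum_squares_bound[of "cmod (f x)" "cmod (g x)"] by (simp add: power2_sum)
      finally show ?thesis .
    qed
    then show "AE x in M. norm ((cmod (f x + g x))\<^sup>2) \<le> norm (2 * (cmod (f x))\<^sup>2 + 2 * (cmod (g x))\<^sup>2)"
      by (intro AE_I2) auto
  qed measurable
  then show ?thesis by (simp add: L2_def)
qed

lemma L2_diff:
  assumes "f \<in> L2 M" "g \<in> L2 M"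
  shows "(\<lambda>x. f x - g x) \<in> L2 M"
  using L2_add[OF assms(1) L2_scale[OF assms(2), of "-1"]] by simp

lemma L2_inner_integrable:
  assumes f: "f \<in> L2 M" and g: "g \<in> L2 M"
  shows "integrable M (\<lambda>x. f x * cnj (g x))"
proof (rule Bochner_Integration.integrable_bound)
  show "integrable M (\<lambda>x. (cmod (f x))\<^sup>2 + (cmod (g x))\<^sup>2)"
    using f g by (simp add: L2_def)
  show "(\<lambda>x. f x * cnj (g x)) \<in> borel_measurable M"
    using f g by (intro borel_measurable_times borel_measurable_cnj) (simp_all add: L2_def)
  have "cmod (f x * cnj (g x)) \<le> (cmod (f x))\<^sup>2 + (cmod (g x))\<^sup>2" for x
    using sum_squares_bound[of "cmod (f x)" "cmod (g x)"] mult_nonneg_nonneg[of "cmod (f x)" "cmod (g x)"]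
    by (simp add: norm_mult del: mult_nonneg_nonneg)
  then show "AE x in M. norm (f x * cnj (g x)) \<le> norm ((cmod (f x))\<^sup>2 + (cmod (g x))\<^sup>2)"
    by (intro AE_I2) auto
qed

lemma L2_rep:
  assumes "f \<in> L2 M"
  shows L2_rep_in: "L2_rep M f \<in> L2 M" and L2_rep_AE: "AE x in M. L2_rep M f x = f x"
  using someI_ex[of "\<lambda>g. g \<in> L2 M \<and> (AE x in M. g x = f x)"] assms
  unfolding L2_rep_def by blast+

text \<open>Functions that agree almost everywhere pose the same choice problem to
  \<open>SOME\<close> and so receive the same representative. Equality of vectors is therefore
  proved by almost-everywhere arguments.\<close>

lemma L2_rep_cong:
  assumes "AE x in M. f x = g x"
  shows "L2_rep M f = L2_rep M g"
proof -
  have "(AE x in M. h x = f x) \<longleftrightarrow> (AE x in M. h x = g x)" for h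
    using assms by auto
  then show ?thesis by (simp add: L2_rep_def)
qed

lemma L2_rep_idem: "f \<in> L2 M \<Longrightarrow> L2_rep M (L2_rep M f) = L2_rep M f"
  by (intro L2_rep_cong L2_rep_AE)

text \<open>By idempotence the image of \<open>L2_rep M\<close> is its fixed-point set, so
  membership is checked without naming a preimage.\<close>

lemma L2_space_carrier:
  "f \<in> carrier (L2_space M) \<longleftrightarrow> f \<in> L2 M \<and> L2_rep M f = f"
  by (auto simp: L2_space_def L2_rep_in L2_rep_idem intro: image_eqI[of f _ f])

lemma L2_space_simps:
  "\<zero>\<^bsub>L2_space M\<^esub> = L2_rep M (\<lambda>x. 0)"
  "f \<oplus>\<^bsub>L2_space M\<^esub> g = L2_rep M (\<lambda>x. f x + g x)"
  "a \<odot>\<^bsub>L2_space M\<^esub> f = L2_rep M (\<lambda>x. a * f x)"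
  "cinner (L2_space M) f g = (LINT x|M. f x * cnj (g x))"
  by (simp_all add: L2_space_def)

lemma L2_rep_carrier: "f \<in> L2 M \<Longrightarrow> L2_rep M f \<in> carrier (L2_space M)"
  by (simp add: L2_space_carrier L2_rep_in L2_rep_idem)

lemma L2_space_in: "f \<in> carrier (L2_space M) \<Longrightarrow> f \<in> L2 M"
  by (simp add: L2_space_carrier)

lemma L2_rep_add_left:
  "f \<in> L2 M \<Longrightarrow> L2_rep M (\<lambda>x. L2_rep M f x + g x) = L2_rep M (\<lambda>x. f x + g x)"
  using L2_rep_AE[of f M] by (intro L2_rep_cong) auto

lemma L2_rep_add_right:
  "g \<in> L2 M \<Longrightarrow> L2_rep M (\<lambda>x. f x + L2_rep M g x) = L2_rep M (\<lambda>x. f x + g x)"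
  using L2_rep_AE[of g M] by (intro L2_rep_cong) auto

lemma L2_rep_scale:
  "f \<in> L2 M \<Longrightarrow> L2_rep M (\<lambda>x. a * L2_rep M f x) = L2_rep M (\<lambda>x. a * f x)"
  using L2_rep_AE[of f M] by (intro L2_rep_cong) auto

lemmas L2_rep_arith = L2_rep_add_left L2_rep_add_right L2_rep_scale

lemma module_L2_space: "module complex_field (L2_space M)"
proof -
  note defs = L2_space_simps L2_rep_arith L2_rep_carrier L2_add L2_scale
  have ab: "abelian_group (L2_space M)"
  proof (rule abelian_groupI)
    fix f assume f: "f \<in> carrier (L2_space M)"
    have "L2_rep M (\<lambda>x. (-1) * f x) \<oplus>\<^bsub>L2_space M\<^esub> f = \<zero>\<^bsub>L2_space M\<^esub>"
      unfolding L2_space_simps using L2_scale[OF L2_space_in[OF f], of "-1"]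
      by (subst L2_rep_add_left) auto
    then show "\<exists>g\<in>carrier (L2_space M). g \<oplus>\<^bsub>L2_space M\<^esub> f = \<zero>\<^bsub>L2_space M\<^esub>"
      using L2_rep_carrier[OF L2_scale[OF L2_space_in[OF f], of "-1"]] by blast
  qed (auto simp: defs L2_space_in L2_space_carrier L2_rep_in L2_rep_idem add_ac)
  show ?thesis
    by (rule moduleI[OF cring_complex_field ab])
      (auto simp: defs L2_space_in L2_space_carrier L2_rep_in L2_rep_idem algebra_simps)
qed

lemma L2_space_minus:
  assumes f: "f \<in> carrier (L2_space M)" and g: "g \<in> carrier (L2_space M)"
  shows "f \<ominus>\<^bsub>L2_space M\<^esub> g = L2_rep M (\<lambda>x. f x - g x)"
proof -
  interpret module complex_field "L2_space M" by (rule module_L2_space)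
  have m: "(\<lambda>x. - g x) \<in> L2 M" using L2_scale[OF L2_space_in[OF g], of "-1"] by simp
  have "\<ominus>\<^bsub>L2_space M\<^esub> g = L2_rep M (\<lambda>x. - g x)"
    by (rule M.minus_equality[OF _ g L2_rep_carrier[OF m]])
      (simp add: L2_space_simps L2_rep_add_left[OF m])
  then show ?thesis by (simp add: a_minus_def L2_space_simps L2_rep_add_right[OF m])
qed

lemma hnorm_L2_rep:
  assumes "f \<in> L2 M"
  shows "hnorm (L2_space M) (L2_rep M f) = sqrt (LINT x|M. (cmod (f x))\<^sup>2)"
proof -
  have [measurable]: "f \<in> borel_measurable M" "L2_rep M f \<in> borel_measurable M"
    using L2_rep_in[OF assms] assms by (simp_all add: L2_def)
  have "(LINT x|M. L2_rep M f x * cnj (L2_rep M f x)) = (LINT x|M. of_real ((cmod (f x))\<^sup>2))"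
  proof (rule integral_cong_AE)
    show "AE x in M. L2_rep M f x * cnj (L2_rep M f x) = of_real ((cmod (f x))\<^sup>2)"
      using L2_rep_AE[OF assms] by eventually_elim (simp only: complex_norm_square)
  qed measurable
  also have "\<dots> = complex_of_real (LINT x|M. (cmod (f x))\<^sup>2)" by (rule integral_complex_of_real)
  finally show ?thesis by (simp add: hnorm_def L2_space_simps)
qed

lemma hdist_L2_space:
  assumes "f \<in> carrier (L2_space M)" "g \<in> carrier (L2_space M)"
  shows "hdist (L2_space M) f g = sqrt (LINT x|M. (cmod (f x - g x))\<^sup>2)"
  using assms by (simp add: hdist_def L2_space_minus hnorm_L2_rep L2_diff L2_space_in)

section \<open>Completeness of the space of square-integrable functions\<close>

lemma (in sigma_finite_measure) ex_pos_square_integrable: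
  obtains w :: "'a \<Rightarrow> real" where "w \<in> borel_measurable M" "integrable M (\<lambda>x. (w x)\<^sup>2)"
    "\<And>x. x \<in> space M \<Longrightarrow> 0 < w x"
proof -
  obtain h where h [measurable]: "h \<in> borel_measurable M" and fin: "integral\<^sup>N M h \<noteq> \<infinity>"
    and pos: "\<And>x. x \<in> space M \<Longrightarrow> 0 < h x \<and> h x < \<infinity>"
    using Ex_finite_integrable_function by auto
  have "integrable M (\<lambda>x. enn2real (h x))"
    by (rule integrableI_nn_integral_finite[where x = "enn2real (integral\<^sup>N M h)"])
      (use fin pos in \<open>auto intro!: nn_integral_cong simp: top.not_eq_extremum\<close>)
  then show ?thesis
    using pos by (intro that[of "\<lambda>x. sqrt (enn2real (h x))"]) (auto simp: enn2real_positive_iff)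
qed

text \<open>Riesz-Fischer. Multiplication by a positive square-integrable weight turns the sequence
  into an L1-Cauchy one, which has an almost everywhere convergent subsequence; Fatou's lemma then
  upgrades pointwise convergence to convergence in mean square.\<close>

theorem (in sigma_finite_measure) L2_complete:
  fixes f :: "nat \<Rightarrow> 'a \<Rightarrow> complex"
  assumes f: "\<And>n. f n \<in> L2 M"
    and cauchy: "\<And>e. e > 0 \<Longrightarrow> \<exists>N. \<forall>m\<ge>N. \<forall>n\<ge>N. (LINT x|M. (cmod (f m x - f n x))\<^sup>2) < e"
  obtains F where "F \<in> L2 M" "(\<lambda>n. LINT x|M. (cmod (f n x - F x))\<^sup>2) \<longlonglongrightarrow> 0"
proof -
  obtain w :: "'a \<Rightarrow> real" where [measurable]: "w \<in> borel_measurable M"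
    and w: "integrable M (\<lambda>x. (w x)\<^sup>2)" and wpos: "\<And>x. x \<in> space M \<Longrightarrow> 0 < w x"
    using ex_pos_square_integrable by blast
  have [measurable]: "f n \<in> borel_measurable M" for n using f by (rule L2_measurable)
  have wL2: "(\<lambda>x. complex_of_real (w x)) \<in> L2 M" using w by (simp add: L2_def)
  define s where "s = (\<lambda>n x. complex_of_real (w x) * f n x)"
  have wint: "integrable M (\<lambda>x. complex_of_real (w x) * g x)" if "g \<in> L2 M" for g
  proof -
    have g [measurable]: "g \<in> borel_measurable M" using that by (rule L2_measurable)
    have "(\<lambda>x. cnj (g x)) \<in> L2 M" using that by (simp add: L2_def)
    from L2_inner_integrable[OF wL2 this] show ?thesis by simp
  qed
  have sint: "integrable M (s n)" for n unfolding s_def by (rule wint[OF f])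
  have "\<exists>N. \<forall>i\<ge>N. \<forall>j\<ge>N. (LINT x|M. cmod (s i x - s j x)) < e" if "e > 0" for e
  proof -
    \<comment> \<open>The summand 1 makes \<open>c\<close> positive, so that division by it is
      harmless.\<close>
    define c where "c = (LINT x|M. (w x)\<^sup>2) + 1"
    have c: "c > 0" unfolding c_def by (intro add_nonneg_pos) auto
    obtain N where N: "\<And>m n. m \<ge> N \<Longrightarrow> n \<ge> N \<Longrightarrow> (LINT x|M. (cmod (f m x - f n x))\<^sup>2) < e\<^sup>2 / c"
      using cauchy[of "e\<^sup>2 / c"] \<open>e > 0\<close> c by auto
    have "(LINT x|M. cmod (s i x - s j x)) < e" if ij: "i \<ge> N" "j \<ge> N" for i j
    proof -
      define d where "d = (\<lambda>x. f i x - f j x)"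
      have d: "d \<in> L2 M" unfolding d_def by (intro L2_diff f)
      have sd: "cmod (s i x - s j x) = cmod (complex_of_real (w x) * d x)" for x
        by (simp add: s_def d_def algebra_simps)
      \<comment> \<open>The inequality \<open>2 * a * b <= a^2 + b^2\<close>, with weights balanced
        so that either term contributes less than \<open>e / 2\<close>.\<close>
      have "(LINT x|M. cmod (s i x - s j x)) \<le>
          (LINT x|M. (e / (2 * c)) * (w x)\<^sup>2 + (c / (2 * e)) * (cmod (d x))\<^sup>2)"
      proof (rule integral_mono)
        show "integrable M (\<lambda>x. cmod (s i x - s j x))"
          unfolding sd by (intro integrable_norm wint d)
        show "integrable M (\<lambda>x. (e / (2 * c)) * (w x)\<^sup>2 + (c / (2 * e)) * (cmod (d x))\<^sup>2)"
          using w L2_integrable[OF d] by simp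
        fix x
        have "2 * (e * \<bar>w x\<bar>) * (c * cmod (d x)) \<le> (e * \<bar>w x\<bar>)\<^sup>2 + (c * cmod (d x))\<^sup>2"
          by (rule sum_squares_bound)
        then show "cmod (s i x - s j x) \<le> (e / (2 * c)) * (w x)\<^sup>2 + (c / (2 * e)) * (cmod (d x))\<^sup>2"
          using c \<open>e > 0\<close> by (simp add: sd norm_mult field_simps power2_eq_square)
      qed
      also have "\<dots> = (e / (2 * c)) * (c - 1) + (c / (2 * e)) * (LINT x|M. (cmod (d x))\<^sup>2)"
        using w L2_integrable[OF d] by (simp add: c_def)
      also have "\<dots> < (e / (2 * c)) * c + (c / (2 * e)) * (e\<^sup>2 / c)"
        using N[OF ij] c \<open>e > 0\<close> unfolding d_def
        by (intro add_strict_mono mult_strict_left_mono) auto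
      also have "\<dots> = e" using c \<open>e > 0\<close> by (simp add: power2_eq_square)
      finally show ?thesis .
    qed
    then show ?thesis by blast
  qed
  then obtain r where r: "strict_mono r" and cauchy_r: "AE x in M. Cauchy (\<lambda>i. s (r i) x)"
    using cauchy_L1_AE_cauchy_subseq[of M s, OF sint] by blast
  from AE_space cauchy_r have ae: "AE x in M. convergent (\<lambda>i. f (r i) x)"
  proof eventually_elim
    case (elim x)
    \<comment> \<open>Dividing by the positive weight transfers convergence back to the original
      values.\<close>
    have "(\<lambda>i. f (r i) x) = (\<lambda>i. complex_of_real (1 / w x) * s (r i) x)"
      using wpos[OF elim(1)] by (simp add: s_def fun_eq_iff)
    then show ?case
      using convergent_mult[OF convergent_const elim(2)[unfolded Cauchy_convergent_iff]] by metis
  qed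
  define F where "F = (\<lambda>x. lim (\<lambda>i. f (r i) x))"
  have [measurable]: "F \<in> borel_measurable M" unfolding F_def by measurable
  have lim: "AE x in M. (\<lambda>i. f (r i) x) \<longlonglongrightarrow> F x"
    using ae by eventually_elim (simp add: F_def convergent_LIMSEQ_iff)
  have key: "\<exists>N. \<forall>n\<ge>N. (\<lambda>x. f n x - F x) \<in> L2 M \<and> (LINT x|M. (cmod (f n x - F x))\<^sup>2) \<le> e" if "e > 0" for e
  proof -
    obtain N where N: "\<And>m n. m \<ge> N \<Longrightarrow> n \<ge> N \<Longrightarrow> (LINT x|M. (cmod (f m x - f n x))\<^sup>2) < e"
      using cauchy[OF \<open>e > 0\<close>] by auto
    have "(\<lambda>x. f n x - F x) \<in> L2 M \<and> (LINT x|M. (cmod (f n x - F x))\<^sup>2) \<le> e" if n: "n \<ge> N" for n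
    proof -
      \<comment> \<open>Fatou's lemma with \<open>n\<close> fixed and \<open>r i\<close> tending to
        infinity; the bound \<open>e\<close> holds on a tail because
        \<open>r i >= i >= N\<close>.\<close>
      have "(\<integral>\<^sup>+x. ennreal ((cmod (f n x - F x))\<^sup>2) \<partial>M) =
          (\<integral>\<^sup>+x. liminf (\<lambda>i. ennreal ((cmod (f n x - f (r i) x))\<^sup>2)) \<partial>M)"
      proof (rule nn_integral_cong_AE)
        show "AE x in M. ennreal ((cmod (f n x - F x))\<^sup>2) = liminf (\<lambda>i. ennreal ((cmod (f n x - f (r i) x))\<^sup>2))"
          using lim
        proof eventually_elim
          case (elim x)
          have "(\<lambda>i. ennreal ((cmod (f n x - f (r i) x))\<^sup>2)) \<longlonglongrightarrow> ennreal ((cmod (f n x - F x))\<^sup>2)"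
            by (intro tendsto_ennrealI tendsto_intros elim)
          then show ?case by (rule lim_imp_Liminf[OF trivial_limit_sequentially, symmetric])
        qed
      qed
      also have "\<dots> \<le> liminf (\<lambda>i. \<integral>\<^sup>+x. ennreal ((cmod (f n x - f (r i) x))\<^sup>2) \<partial>M)"
        by (rule nn_integral_liminf) measurable
      also have "\<dots> \<le> ennreal e"
      proof (rule Liminf_le)
        have "(\<integral>\<^sup>+x. ennreal ((cmod (f n x - f (r i) x))\<^sup>2) \<partial>M) \<le> ennreal e" if "i \<ge> N" for i
        proof -
          have "r i \<ge> N" using seq_suble[OF r, of i] that by simp
          then have "(LINT x|M. (cmod (f n x - f (r i) x))\<^sup>2) < e" by (intro N n)
          then show ?thesis
            using L2_integrable[OF L2_diff[OF f f]] by (subst nn_integral_eq_integral) (auto intro: ennreal_leI)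
        qed
        then show "\<forall>\<^sub>F i in sequentially. (\<integral>\<^sup>+x. ennreal ((cmod (f n x - f (r i) x))\<^sup>2) \<partial>M) \<le> ennreal e"
          by (auto simp: eventually_sequentially)
      qed simp
      finally have le: "(\<integral>\<^sup>+x. ennreal ((cmod (f n x - F x))\<^sup>2) \<partial>M) \<le> ennreal e" .
      then have int: "integrable M (\<lambda>x. (cmod (f n x - F x))\<^sup>2)"
        by (intro integrableI_bounded) (auto intro: le_less_trans)
      moreover have "(LINT x|M. (cmod (f n x - F x))\<^sup>2) \<le> e"
        using le \<open>e > 0\<close> nn_integral_eq_integral[OF int] by simp
      ultimately show ?thesis by (simp add: L2_def)
    qed
    then show ?thesis by blast
  qed
  show ?thesis
  proof (rule that)
    obtain N where N: "(\<lambda>x. f N x - F x) \<in> L2 M" using key[of 1] by auto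
    \<comment> \<open>\<open>F = f N - (f N - F)\<close>, where the difference is square integrable
      by \<open>key\<close>.\<close>
    show "F \<in> L2 M" using L2_diff[OF f N, of N] by simp
    show "(\<lambda>n. LINT x|M. (cmod (f n x - F x))\<^sup>2) \<longlonglongrightarrow> 0"
    proof (rule LIMSEQ_I)
      fix e :: real assume "e > 0"
      then obtain N where N: "\<And>n. n \<ge> N \<Longrightarrow> (LINT x|M. (cmod (f n x - F x))\<^sup>2) \<le> e / 2"
        using key[of "e / 2"] by auto
      then have "norm ((LINT x|M. (cmod (f n x - F x))\<^sup>2) - 0) < e" if "n \<ge> N" for n
        using N[OF that] \<open>e > 0\<close> by simp
      then show "\<exists>N. \<forall>n\<ge>N. norm ((LINT x|M. (cmod (f n x - F x))\<^sup>2) - 0) < e" by blast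
    qed
  qed
qed

theorem (in sigma_finite_measure) complex_hilbert_space_L2: "complex_hilbert_space (L2_space M)"
proof (intro complex_hilbert_space.intro complex_hilbert_space_axioms.intro module_L2_space)
  fix f g h assume fgh: "f \<in> carrier (L2_space M)" "g \<in> carrier (L2_space M)" "h \<in> carrier (L2_space M)"
  note L = fgh[THEN L2_space_in]
  have [measurable]: "f \<in> borel_measurable M" "g \<in> borel_measurable M" "h \<in> borel_measurable M"
    "L2_rep M (\<lambda>x. f x + g x) \<in> borel_measurable M"
    using L L2_rep_in[OF L2_add[OF L(1,2)]] by (simp_all add: L2_def)
  have "(LINT x|M. L2_rep M (\<lambda>x. f x + g x) x * cnj (h x)) = (LINT x|M. f x * cnj (h x) + g x * cnj (h x))"
  proof (rule integral_cong_AE)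
    show "AE x in M. L2_rep M (\<lambda>x. f x + g x) x * cnj (h x) = f x * cnj (h x) + g x * cnj (h x)"
      using L2_rep_AE[OF L2_add[OF L(1,2)]] by eventually_elim (simp add: algebra_simps)
  qed measurable
  then show "cinner (L2_space M) (f \<oplus>\<^bsub>L2_space M\<^esub> g) h =
      cinner (L2_space M) f h + cinner (L2_space M) g h"
    using L by (simp add: L2_space_simps L2_inner_integrable)
next
  fix f g a assume fg: "f \<in> carrier (L2_space M)" "g \<in> carrier (L2_space M)"
  note L = fg[THEN L2_space_in]
  have [measurable]: "f \<in> borel_measurable M" "g \<in> borel_measurable M"
    "L2_rep M (\<lambda>x. a * f x) \<in> borel_measurable M"
    using L L2_rep_in[OF L2_scale[OF L(1)]] by (simp_all add: L2_def)
  have "(LINT x|M. L2_rep M (\<lambda>x. a * f x) x * cnj (g x)) = (LINT x|M. a * (f x * cnj (g x)))"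
  proof (rule integral_cong_AE)
    show "AE x in M. L2_rep M (\<lambda>x. a * f x) x * cnj (g x) = a * (f x * cnj (g x))"
      using L2_rep_AE[OF L2_scale[OF L(1), of a]] by eventually_elim simp
  qed measurable
  then show "cinner (L2_space M) (a \<odot>\<^bsub>L2_space M\<^esub> f) g = a * cinner (L2_space M) f g"
    by (simp add: L2_space_simps)
next
  fix f g
  have "(LINT x|M. g x * cnj (f x)) = (LINT x|M. cnj (f x * cnj (g x)))"
    by (simp add: mult.commute)
  also have "\<dots> = cnj (LINT x|M. f x * cnj (g x))" by (rule Bochner_Integration.integral_cnj)
  finally show "cinner (L2_space M) g f = cnj (cinner (L2_space M) f g)"
    by (simp add: L2_space_simps)
next
  fix f assume f: "f \<in> carrier (L2_space M)" and nz: "f \<noteq> \<zero>\<^bsub>L2_space M\<^esub>"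
  have L: "f \<in> L2 M" "L2_rep M f = f" using f by (simp_all add: L2_space_carrier)
  have [measurable]: "f \<in> borel_measurable M" using L by (simp add: L2_def)
  have "\<not> (AE x in M. f x = 0)"
    using nz L2_rep_cong[of f "\<lambda>x. 0" M] L by (auto simp: L2_space_simps)
  then have "\<not> (AE x in M. (cmod (f x))\<^sup>2 = 0)" by simp
  then have "(LINT x|M. (cmod (f x))\<^sup>2) \<noteq> 0"
    using integral_nonneg_eq_0_iff_AE[OF L2_integrable[OF L(1)]] by auto
  then have "0 < (LINT x|M. (cmod (f x))\<^sup>2)"
    using Bochner_Integration.integral_nonneg[of M "\<lambda>x. (cmod (f x))\<^sup>2"] by (auto simp: order.strict_iff_order)
  then have "0 < hnorm (L2_space M) f" using hnorm_L2_rep[OF L(1)] L(2) by simp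
  then show "0 < Re (cinner (L2_space M) f f)" by (simp add: hnorm_def)
next
  fix \<sigma> :: "nat \<Rightarrow> _" assume s: "range \<sigma> \<subseteq> carrier (L2_space M)"
    and C: "\<forall>e>0. \<exists>N. \<forall>m\<ge>N. \<forall>n\<ge>N. hdist (L2_space M) (\<sigma> m) (\<sigma> n) < e"
  have s: "\<sigma> n \<in> carrier (L2_space M)" for n using s by auto
  note sL = s[THEN L2_space_in]
  obtain F where F: "F \<in> L2 M" "(\<lambda>n. LINT x|M. (cmod (\<sigma> n x - F x))\<^sup>2) \<longlonglongrightarrow> 0"
  proof (rule L2_complete[of \<sigma>])
    fix e :: real assume "e > 0"
    then obtain N where "\<And>m n. m \<ge> N \<Longrightarrow> n \<ge> N \<Longrightarrow> hdist (L2_space M) (\<sigma> m) (\<sigma> n) < sqrt e"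
      using C[rule_format, of "sqrt e"] by auto
    then show "\<exists>N. \<forall>m\<ge>N. \<forall>n\<ge>N. (LINT x|M. (cmod (\<sigma> m x - \<sigma> n x))\<^sup>2) < e"
      by (auto simp: hdist_L2_space s)
  qed (use sL in auto)
  have "hdist (L2_space M) (\<sigma> n) (L2_rep M F) = sqrt (LINT x|M. (cmod (\<sigma> n x - F x))\<^sup>2)" for n
  proof -
    have [measurable]: "F \<in> borel_measurable M" "L2_rep M F \<in> borel_measurable M" "\<sigma> n \<in> borel_measurable M"
      using F(1) L2_rep_in[OF F(1)] sL by (simp_all add: L2_def)
    have "(LINT x|M. (cmod (\<sigma> n x - L2_rep M F x))\<^sup>2) = (LINT x|M. (cmod (\<sigma> n x - F x))\<^sup>2)"
      by (rule integral_cong_AE) (use L2_rep_AE[OF F(1)] in auto)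
    then show ?thesis by (simp add: hdist_L2_space s L2_rep_carrier F(1))
  qed
  moreover have "(\<lambda>n. sqrt (LINT x|M. (cmod (\<sigma> n x - F x))\<^sup>2)) \<longlonglongrightarrow> 0"
    using tendsto_real_sqrt[OF F(2)] by simp
  ultimately show "\<exists>x\<in>carrier (L2_space M). (\<lambda>n. hdist (L2_space M) (\<sigma> n) x) \<longlonglongrightarrow> 0"
    by (intro bexI[of _ "L2_rep M F"] L2_rep_carrier F(1)) simp
qed

section \<open>Densities of bi-Lipschitz images of Lebesgue measure\<close>

text \<open>Half-open intervals are closed under intersection and generate the Borel sets;
  finiteness on them supplies the exhausting sequence that the uniqueness theorem asks for.\<close>

lemma measure_eqI_Ioc:
  fixes M N :: "real measure"
  assumes sets: "sets M = sets borel" "sets N = sets borel"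
    and eq: "\<And>a b. a \<le> b \<Longrightarrow> emeasure M {a<..b} = emeasure N {a<..b}"
    and fin: "\<And>a b. emeasure M {a<..b} \<noteq> \<infinity>"
  shows "M = N"
proof (rule measure_eqI_generator_eq[where E = "range (\<lambda>(a, b). {a<..b})" and \<Omega> = UNIV
      and A = "\<lambda>n::nat. {- real n<..real n}"])
  show "Int_stable (range (\<lambda>(a, b). {a<..b::real}))"
  proof (rule Int_stableI)
    fix A B assume "A \<in> range (\<lambda>(a, b). {a<..b::real})" "B \<in> range (\<lambda>(a, b). {a<..b::real})"
    then obtain a b c d where "A = {a<..b}" "B = {c<..d}" by auto
    then have "A \<inter> B = {max a c<..min b d}" by auto
    then show "A \<inter> B \<in> range (\<lambda>(a, b). {a<..b::real})"
      by (metis (mono_tags, lifting) case_prod_conv rangeI)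
  qed
  show "sets M = sigma_sets UNIV (range (\<lambda>(a, b). {a<..b::real}))"
    "sets N = sigma_sets UNIV (range (\<lambda>(a, b). {a<..b::real}))"
    by (simp_all add: sets borel_sigma_sets_Ioc)
  fix X assume "X \<in> range (\<lambda>(a, b). {a<..b::real})"
  then obtain a b where X: "X = {a<..b}" by auto
  show "emeasure M X = emeasure N X" by (cases "a \<le> b") (simp_all add: X eq)
qed (use fin UN_Ioc_eq_UNIV in auto)

text \<open>Serves to compare the sum of two Stieltjes measures with a multiple of Lebesgue
  measure.\<close>

lemma ex_sum_measure:
  assumes "sets N = sets M"
  obtains K where "sets K = sets M" "\<And>A. A \<in> sets M \<Longrightarrow> emeasure K A = emeasure M A + emeasure N A"
proof -
  define K where "K = measure_of (space M) (sets M) (\<lambda>A. emeasure M A + emeasure N A)"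
  have s: "sets K = sets M" unfolding K_def by (simp add: sets.space_closed)
  have "emeasure K A = emeasure M A + emeasure N A" if "A \<in> sets M" for A
    unfolding K_def
  proof (rule emeasure_measure_of_sigma[OF sets.sigma_algebra_axioms _ _ that])
    show "countably_additive (sets M) (\<lambda>A. emeasure M A + emeasure N A)"
    proof (rule countably_additiveI)
      fix A :: "nat \<Rightarrow> _" assume A: "range A \<subseteq> sets M" "disjoint_family A"
      have "(\<Sum>i. emeasure M (A i) + emeasure N (A i)) = (\<Sum>i. emeasure M (A i)) + (\<Sum>i. emeasure N (A i))"
        by (intro suminf_add[symmetric]) auto
      then show "(\<Sum>i. emeasure M (A i) + emeasure N (A i)) = emeasure M (\<Union> (range A)) + emeasure N (\<Union> (range A))"
        using A assms by (simp add: suminf_emeasure)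
    qed
  qed (simp add: positive_def)
  with s show ?thesis by (rule that)
qed

lemma continuous_on_lipschitz_real:
  fixes F :: "real \<Rightarrow> real"
  assumes "\<And>x y. x \<le> y \<Longrightarrow> \<bar>F y - F x\<bar> \<le> L * (y - x)"
  shows "continuous_on UNIV F"
proof -
  \<comment> \<open>\<open>lipschitz_on\<close> asks for a nonnegative constant, hence the absolute
    value of \<open>L\<close>.\<close>
  have *: "\<bar>F y - F x\<bar> \<le> \<bar>L\<bar> * (y - x)" if "x \<le> y" for x y
  proof -
    have "L * (y - x) \<le> \<bar>L\<bar> * (y - x)" using that by (intro mult_right_mono) auto
    then show ?thesis using assms[OF that] by simp
  qed
  have "\<bar>F x - F y\<bar> \<le> \<bar>L\<bar> * \<bar>x - y\<bar>" for x y
    using *[of x y] *[of y x] by (cases "x \<le> y") (simp_all add: abs_minus_commute)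
  then have "\<bar>L\<bar>-lipschitz_on UNIV F"
    by (auto simp: lipschitz_on_def dist_real_def)
  then show ?thesis by (rule lipschitz_on_continuous_on)
qed

text \<open>The Stieltjes measures of \<open>F\<close> and of \<open>L * x - F x\<close> add up to \<open>L\<close> times Lebesgue measure, so
  both are absolutely continuous and their densities add up to \<open>L\<close>.\<close>

lemma lipschitz_increments_density:
  fixes F :: "real \<Rightarrow> real"
  assumes mono: "\<And>x y. x \<le> y \<Longrightarrow> F x \<le> F y"
    and lip: "\<And>x y. x \<le> y \<Longrightarrow> F y - F x \<le> L * (y - x)"
  obtains D where "D \<in> borel_measurable borel" "\<And>x. 0 \<le> D x" "\<And>x. D x \<le> L"
    "\<And>a b. a \<le> b \<Longrightarrow> emeasure (density lborel D) {a<..b} = ennreal (F b - F a)"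
proof -
  have L: "L \<ge> 0" using mono[of 0 1] lip[of 0 1] by simp
  define E where "E = (\<lambda>x. L * x - F x)"
  define \<mu> where "\<mu> = interval_measure F"
  define \<nu> where "\<nu> = interval_measure E"
  have contF: "continuous_on UNIV F"
    by (rule continuous_on_lipschitz_real[of _ L]) (use mono lip in auto)
  then have contE: "continuous_on UNIV E"
    unfolding E_def by (intro continuous_intros)
  have rF: "continuous (at_right a) F" and rE: "continuous (at_right a) E" for a
    using contF contE by (auto simp: continuous_on_eq_continuous_at intro: continuous_at_imp_continuous_within)
  have \<mu>: "emeasure \<mu> {a<..b} = ennreal (F b - F a)" if "a \<le> b" for a b
    unfolding \<mu>_def by (rule emeasure_interval_measure_Ioc[OF that mono rF])
  have "E x \<le> E y" if "x \<le> y" for x y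
    using lip[OF that] by (simp add: E_def algebra_simps)
  then have \<nu>: "emeasure \<nu> {a<..b} = ennreal (E b - E a)" if "a \<le> b" for a b
    unfolding \<nu>_def by (rule emeasure_interval_measure_Ioc[OF that _ rE])
  have sets: "sets \<mu> = sets borel" "sets \<nu> = sets borel" by (simp_all add: \<mu>_def \<nu>_def)
  obtain K where K: "sets K = sets \<mu>" "\<And>A. A \<in> sets \<mu> \<Longrightarrow> emeasure K A = emeasure \<mu> A + emeasure \<nu> A"
    using ex_sum_measure[of \<nu> \<mu>] sets by auto
  have KL: "K = density lborel (\<lambda>_. ennreal L)"
  proof (rule measure_eqI_Ioc)
    fix a b :: real
    show eq: "emeasure K {a<..b} = emeasure (density lborel (\<lambda>_. ennreal L)) {a<..b}" if "a \<le> b"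
    proof -
      have "emeasure K {a<..b} = ennreal (F b - F a) + ennreal (E b - E a)"
        using that by (simp add: K sets \<mu> \<nu>)
      also have "\<dots> = ennreal (L * (b - a))"
        using that mono[OF that] lip[OF that] by (subst ennreal_plus[symmetric]) (auto simp: E_def algebra_simps)
      finally show ?thesis
        using that L by (simp add: emeasure_density nn_integral_cmult_indicator ennreal_mult)
    qed
    show "emeasure K {a<..b} \<noteq> \<infinity>"
    proof (cases "a \<le> b")
      case True
      then show ?thesis using K(2)[of "{a<..b}"] by (simp add: sets \<mu> \<nu>)
    qed simp
  qed (simp_all add: K sets)
  \<comment> \<open>\<open>K\<close> dominates both summands and has a density, so Lebesgue null
    sets are null for \<mu> and \<nu>.\<close>
  have null: "emeasure \<mu> A = 0 \<and> emeasure \<nu> A = 0" if "A \<in> null_sets lborel" for A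
  proof -
    have "A \<in> sets borel" using that by auto
    moreover have "emeasure K A = 0"
      using that absolutely_continuousI_density[of "\<lambda>_. ennreal L" lborel]
      by (auto simp: KL absolutely_continuous_def)
    ultimately show ?thesis using K(2)[of A] by (simp add: sets)
  qed
  have ac: "absolutely_continuous lborel \<mu>" "absolutely_continuous lborel \<nu>"
    using null by (auto simp: absolutely_continuous_def null_sets_def sets)
  obtain f where f [measurable]: "f \<in> borel_measurable lborel" "density lborel f = \<mu>"
    using lborel.sigma_finite_measure_axioms[THEN sigma_finite_measure.Radon_Nikodym, OF ac(1)] sets by auto
  obtain f' where f' [measurable]: "f' \<in> borel_measurable lborel" "density lborel f' = \<nu>"
    using lborel.sigma_finite_measure_axioms[THEN sigma_finite_measure.Radon_Nikodym, OF ac(2)] sets by auto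
  have "density lborel (\<lambda>x. f x + f' x) = density lborel (\<lambda>_. ennreal L)"
  proof (rule measure_eqI)
    fix A assume "A \<in> sets (density lborel (\<lambda>x. f x + f' x))"
    then have A [measurable]: "A \<in> sets borel" by simp
    have "emeasure (density lborel (\<lambda>x. f x + f' x)) A = emeasure (density lborel f) A + emeasure (density lborel f') A"
      by (simp add: emeasure_density distrib_right nn_integral_add)
    then show "emeasure (density lborel (\<lambda>x. f x + f' x)) A = emeasure (density lborel (\<lambda>_. ennreal L)) A"
      using K(2)[of A] by (simp add: f f' sets KL)
  qed simp
  then have "AE x in lborel. f x + f' x = ennreal L"
    by (intro sigma_finite_measure.density_unique[OF lborel.sigma_finite_measure_axioms]) auto
  then have fL: "AE x in lborel. f x \<le> ennreal L"
    by eventually_elim (metis le_iff_add)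
  \<comment> \<open>The bound by \<open>L\<close> holds for \<open>f\<close> only almost everywhere.
    Truncation makes it hold everywhere and alters \<open>f\<close> on a null set only.\<close>
  define D where "D = (\<lambda>x. min L (enn2real (f x)))"
  have "AE x in lborel. ennreal (D x) = f x"
    using fL
  proof eventually_elim
    case (elim x)
    then have "enn2real (f x) \<le> L" using L by (simp add: enn2real_leI)
    moreover have "f x < \<infinity>" using elim by (simp add: le_less_trans)
    ultimately show ?case by (simp add: D_def)
  qed
  moreover have [measurable]: "D \<in> borel_measurable borel" using f(1) unfolding D_def by simp
  ultimately have "density lborel D = \<mu>"
    unfolding f(2)[symmetric] by (intro density_cong) auto
  then show ?thesis
    using \<mu> L by (intro that[of D]) (auto simp: D_def)
qed

text \<open>Removing the slope \<open>1 / L\<close> leaves a monotone function with Lipschitz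
  constant \<open>L - 1 / L\<close>; adding \<open>1 / L\<close> back to its density produces the
  lower bound.\<close>

lemma bilipschitz_increments_density:
  fixes h :: "real \<Rightarrow> real"
  assumes L: "1 \<le> L"
    and lower: "\<And>x y. x \<le> y \<Longrightarrow> 1 / L * (y - x) \<le> h y - h x"
    and upper: "\<And>x y. x \<le> y \<Longrightarrow> h y - h x \<le> L * (y - x)"
  obtains D where "D \<in> borel_measurable borel" "\<And>x. 1 / L \<le> D x" "\<And>x. D x \<le> L"
    "\<And>a b. a \<le> b \<Longrightarrow> emeasure (density lborel D) {a<..b} = ennreal (h b - h a)"
proof -
  obtain D where D [measurable]: "D \<in> borel_measurable borel"
    and D': "\<And>x. 0 \<le> D x" "\<And>x. D x \<le> L - 1 / L"
      "\<And>a b. a \<le> b \<Longrightarrow> emeasure (density lborel D) {a<..b} = ennreal ((h b - 1 / L * b) - (h a - 1 / L * a))"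
  proof (rule lipschitz_increments_density[of "\<lambda>x. h x - 1 / L * x" "L - 1 / L"])
    fix x y :: real assume "x \<le> y"
    from lower[OF this] upper[OF this]
    show "h x - 1 / L * x \<le> h y - 1 / L * y"
      "h y - 1 / L * y - (h x - 1 / L * x) \<le> (L - 1 / L) * (y - x)"
      by (simp_all add: algebra_simps diff_divide_distrib)
  qed blast
  show ?thesis
  proof (rule that[of "\<lambda>x. D x + 1 / L"])
    fix a b :: real assume ab: "a \<le> b"
    have "emeasure (density lborel (\<lambda>x. ennreal (D x + 1 / L))) {a<..b} =
        emeasure (density lborel D) {a<..b} + emeasure (density lborel (\<lambda>x. ennreal (1 / L))) {a<..b}"
      using D' L by (simp add: emeasure_density distrib_right nn_integral_add ennreal_plus)
    also have "\<dots> = ennreal ((h b - 1 / L * b) - (h a - 1 / L * a)) + ennreal (1 / L * (b - a))"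
      unfolding D'(3)[OF ab] using ab L by (simp add: emeasure_density nn_integral_cmult_indicator ennreal_mult[symmetric])
    also have "\<dots> = ennreal (h b - h a)"
      using ab L lower[OF ab]
      by (subst ennreal_plus[symmetric]) (auto simp: algebra_simps diff_divide_distrib intro: divide_right_mono)
    finally show "emeasure (density lborel (\<lambda>x. ennreal (D x + 1 / L))) {a<..b} = ennreal (h b - h a)" .
  qed (use D' in \<open>auto simp: le_diff_eq\<close>)
qed

text \<open>The infimum is attained: for fixed \<open>x\<close> and \<open>y\<close> with
  \<open>x \<noteq> y\<close> the two inequalities say that \<open>L\<close> is at least a
  difference quotient and its reciprocal, and such bounds pass to infima.\<close>

lemma bilip_bound_BiLip:
  assumes "bilip_bound f L"
  shows "bilip_bound f (BiLip f)"
proof -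
  let ?X = "{L. bilip_bound f L}"
  have ne: "?X \<noteq> {}" using assms by auto
  have bdd: "bdd_below ?X" by (rule bdd_belowI[of _ 1]) (simp add: bilip_bound_def)
  have ge1: "1 \<le> BiLip f"
    unfolding BiLip_def using ne by (intro cInf_greatest) (auto simp: bilip_bound_def)
  have "1 / BiLip f * \<bar>x - y\<bar> \<le> \<bar>f x - f y\<bar> \<and> \<bar>f x - f y\<bar> \<le> BiLip f * \<bar>x - y\<bar>" for x y
  proof (cases "x = y")
    case False
    then have d: "\<bar>x - y\<bar> > 0" by simp
    have X: "1 \<le> M" "\<bar>x - y\<bar> / M \<le> \<bar>f x - f y\<bar>" "\<bar>f x - f y\<bar> \<le> M * \<bar>x - y\<bar>" if "M \<in> ?X" for M
      using that by (auto simp: bilip_bound_def)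
    have "0 < \<bar>x - y\<bar> / L" using d X(1)[of L] assms by simp
    also have "\<dots> \<le> \<bar>f x - f y\<bar>" using X(2)[of L] assms by simp
    finally have p: "\<bar>f x - f y\<bar> > 0" .
    have "\<bar>f x - f y\<bar> / \<bar>x - y\<bar> \<le> BiLip f"
      unfolding BiLip_def using ne X(3) d by (intro cInf_greatest) (auto simp: divide_le_eq)
    moreover have "\<bar>x - y\<bar> / \<bar>f x - f y\<bar> \<le> BiLip f"
      unfolding BiLip_def
    proof (rule cInf_greatest[OF ne])
      fix M assume "M \<in> ?X"
      with X(1,2)[OF this] p show "\<bar>x - y\<bar> / \<bar>f x - f y\<bar> \<le> M"
        by (simp add: divide_le_eq pos_divide_le_eq mult.commute)
    qed
    ultimately show ?thesis
      using d p ge1 by (simp add: divide_le_eq pos_divide_le_eq mult.commute)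
  qed simp
  with ge1 show ?thesis by (simp add: bilip_bound_def)
qed

lemma bilip_bound_mono:
  assumes "bilip_bound f L" "L \<le> M"
  shows "bilip_bound f M"
  unfolding bilip_bound_def
proof (intro conjI allI)
  have L: "1 \<le> L" using assms(1) by (simp add: bilip_bound_def)
  then show "1 \<le> M" using assms(2) by simp
  fix x y
  have a: "1 / L * \<bar>x - y\<bar> \<le> \<bar>f x - f y\<bar>" "\<bar>f x - f y\<bar> \<le> L * \<bar>x - y\<bar>"
    using assms(1) by (simp_all add: bilip_bound_def)
  have "1 / M * \<bar>x - y\<bar> \<le> 1 / L * \<bar>x - y\<bar>" "L * \<bar>x - y\<bar> \<le> M * \<bar>x - y\<bar>"
    using L assms(2) by (intro mult_right_mono; simp add: frac_le)+
  with a show "1 / M * \<bar>x - y\<bar> \<le> \<bar>f x - f y\<bar>" "\<bar>f x - f y\<bar> \<le> M * \<bar>x - y\<bar>" by linarith+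
qed

lemma bilip_bound_inverse:
  assumes "bilip_bound f L" "\<And>x. f (h x) = x"
  shows "bilip_bound h L"
  unfolding bilip_bound_def
proof (intro conjI allI)
  show L: "1 \<le> L" using assms(1) by (simp add: bilip_bound_def)
  fix x y
  have "1 / L * \<bar>h x - h y\<bar> \<le> \<bar>x - y\<bar>" "\<bar>x - y\<bar> \<le> L * \<bar>h x - h y\<bar>"
    using assms unfolding bilip_bound_def by metis+
  then show "1 / L * \<bar>x - y\<bar> \<le> \<bar>h x - h y\<bar>" "\<bar>h x - h y\<bar> \<le> L * \<bar>x - y\<bar>"
    using L by (auto simp: field_simps)
qed

section \<open>Elements of the group and the densities of their push-forwards\<close>

lemma bilip_bd_groupD:
  assumes "g \<in> carrier bilip_bd_group"
  shows "strict_mono g" "bij g" "\<exists>L. bilip_bound g L" "bounded_displacement g"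
    "inv_into UNIV g \<in> carrier bilip_bd_group"
    "inv_into UNIV g (g x) = x" "g (inv_into UNIV g x) = x"
proof -
  show g: "strict_mono g" "\<exists>L. bilip_bound g L" "bounded_displacement g"
    using assms by (auto simp: bilip_bd_group_def homeo_plus_iff)
  obtain h where h: "h \<in> carrier homeo_plus" "\<And>x. h (g x) = x" "\<And>x. g (h x) = x"
    using homeo_plus_inverse assms unfolding bilip_bd_group_def by auto
  show "bij g" by (rule o_bij[of h]) (auto simp: h)
  then show inv: "inv_into UNIV g (g x) = x" "g (inv_into UNIV g x) = x" for x
    by (simp_all add: bij_is_inj bij_is_surj surj_f_inv_f)
  have "inv_into UNIV g = h" using inv h by (metis ext)
  moreover obtain L where "bilip_bound g L" using g by blast
  then have "bilip_bound h L" using h(3) by (rule bilip_bound_inverse)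
  moreover obtain C where "\<And>x. \<bar>g x - x\<bar> \<le> C"
    using g(3) by (auto simp: bounded_displacement_def bdd_above_def)
  then have "\<bar>h x - x\<bar> \<le> C" for x using h(3)[of x] by (metis abs_minus_commute)
  then have "bounded_displacement h"
    unfolding bounded_displacement_def by (intro bdd_aboveI) auto
  ultimately show "inv_into UNIV g \<in> carrier bilip_bd_group"
    using h(1) by (auto simp: bilip_bd_group_def)
qed

lemma bilip_bd_group_measurable:
  assumes "g \<in> carrier bilip_bd_group"
  shows "g \<in> borel_measurable borel"
  using bilip_bd_groupD(1)[OF assms] by (intro borel_measurable_mono strict_mono_mono)

lemma bilip_bd_group_comp:
  assumes "f \<in> carrier bilip_bd_group" "g \<in> carrier bilip_bd_group"
  shows "f \<circ> g \<in> carrier bilip_bd_group"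
  using monoid.m_closed[OF group.is_monoid[OF group_bilip_bd] assms]
  by (simp add: bilip_bd_group_def homeo_plus_def)

lemma id_in_bilip_bd_group: "id \<in> carrier bilip_bd_group"
  using monoid.one_closed[OF group.is_monoid[OF group_bilip_bd]]
  by (simp add: bilip_bd_group_def homeo_plus_def)

text \<open>The Radon-Nikodym derivative of the push-forward of Lebesgue measure, almost everywhere
  the derivative of the inverse of \<open>g\<close>. Nonnegativity is demanded at every point so
  that \<open>ennreal\<close> and \<open>sqrt\<close> can be handled pointwise; the bounds by
  \<open>1 / L\<close> and \<open>L\<close> are recovered almost everywhere only.\<close>

definition push_density :: "(real \<Rightarrow> real) \<Rightarrow> real \<Rightarrow> real" where
  "push_density g = (SOME D. D \<in> borel_measurable borel \<and> (\<forall>x. 0 \<le> D x) \<and>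
     distr lborel lborel g = density lborel (\<lambda>x. ennreal (D x)))"

text \<open>The push-forward gives \<open>{a<..b}\<close> the mass \<open>h b - h a\<close>, where
  \<open>h\<close> is the inverse of \<open>g\<close> and has the same bi-Lipschitz bound.\<close>

lemma push_density_exists:
  assumes g: "g \<in> carrier bilip_bd_group" and L: "bilip_bound g L"
  obtains D where "D \<in> borel_measurable borel" "\<And>x. 1 / L \<le> D x" "\<And>x. D x \<le> L"
    "distr lborel lborel g = density lborel (\<lambda>x. ennreal (D x))"
proof -
  define h where "h = inv_into UNIV g"
  note gD = bilip_bd_groupD[OF g, folded h_def]
  have g_meas [measurable]: "g \<in> borel_measurable borel" by (rule bilip_bd_group_measurable[OF g])
  have hL: "bilip_bound h L" by (rule bilip_bound_inverse[OF L gD(7)])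
  have mono_h: "strict_mono h" using bilip_bd_groupD(1)[OF gD(5)] .
  have h_le: "h x \<le> h y" if "x \<le> y" for x y
    using mono_h that by (simp add: strict_mono_less_eq)
  have incr: "1 / L * (y - x) \<le> h y - h x" "h y - h x \<le> L * (y - x)" if "x \<le> y" for x y
    using hL[unfolded bilip_bound_def, THEN conjunct2, rule_format, of y x] that h_le[OF that]
    by simp_all
  obtain D where D [measurable]: "D \<in> borel_measurable borel"
    and D': "\<And>x. 1 / L \<le> D x" "\<And>x. D x \<le> L"
      "\<And>a b. a \<le> b \<Longrightarrow> emeasure (density lborel D) {a<..b} = ennreal (h b - h a)"
    by (rule bilipschitz_increments_density[of L h]) (use incr hL in \<open>auto simp: bilip_bound_def\<close>)
  have *: "emeasure (distr lborel lborel g) {a<..b} = ennreal (h b - h a)" if "a \<le> b" for a b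
  proof -
    have "x \<in> g -` {a<..b} \<longleftrightarrow> x \<in> {h a<..h b}" for x
      using strict_mono_less[OF mono_h, of a "g x"] strict_mono_less_eq[OF mono_h, of "g x" b]
      by (simp add: gD(6))
    then have "g -` {a<..b} = {h a<..h b}" by blast
    then show ?thesis using h_le[OF that] by (simp add: emeasure_distr)
  qed
  have "distr lborel lborel g = density lborel D"
  proof (rule measure_eqI_Ioc)
    fix a b :: real
    show "emeasure (distr lborel lborel g) {a<..b} \<noteq> \<infinity>"
      by (cases "a \<le> b") (simp_all add: *)
  qed (simp_all add: * D')
  with D D'(1,2) show ?thesis by (rule that)
qed

lemma push_density:
  assumes g: "g \<in> carrier bilip_bd_group"
  shows push_density_measurable: "push_density g \<in> borel_measurable borel"
    and push_density_nonneg: "0 \<le> push_density g x"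
    and distr_eq_push_density: "distr lborel lborel g = density lborel (\<lambda>x. ennreal (push_density g x))"
proof -
  obtain L where L: "bilip_bound g L" using bilip_bd_groupD(3)[OF g] by blast
  obtain D where D: "D \<in> borel_measurable borel" "\<And>x. 1 / L \<le> D x" "\<And>x. D x \<le> L"
      "distr lborel lborel g = density lborel (\<lambda>x. ennreal (D x))"
    by (rule push_density_exists[OF g L]) (rule that)
  have "0 < 1 / L" using L by (simp add: bilip_bound_def)
  then have "0 \<le> D x" for x using D(2)[of x] by linarith
  then have "\<exists>D. D \<in> borel_measurable borel \<and> (\<forall>x. 0 \<le> D x) \<and>
     distr lborel lborel g = density lborel (\<lambda>x. ennreal (D x))"
    using D by blast
  from someI_ex[OF this, folded push_density_def]
  show "push_density g \<in> borel_measurable borel" "0 \<le> push_density g x"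
    "distr lborel lborel g = density lborel (\<lambda>x. ennreal (push_density g x))" by auto
qed

lemma push_density_unique:
  assumes g: "g \<in> carrier bilip_bd_group"
    and D [measurable]: "D \<in> borel_measurable borel" and nn: "\<And>x. 0 \<le> D x"
    and eq: "distr lborel lborel g = density lborel (\<lambda>x. ennreal (D x))"
  shows "AE x in lborel. push_density g x = D x"
proof -
  note [measurable] = push_density_measurable[OF g]
  have "AE x in lborel. ennreal (push_density g x) = ennreal (D x)"
    using eq distr_eq_push_density[OF g]
    by (intro sigma_finite_measure.density_unique[OF lborel.sigma_finite_measure_axioms]) auto
  then show ?thesis by eventually_elim (simp add: nn push_density_nonneg[OF g])
qed

lemma push_density_bounds:
  assumes g: "g \<in> carrier bilip_bd_group" and L: "bilip_bound g L"
  shows "AE x in lborel. 1 / L \<le> push_density g x \<and> push_density g x \<le> L"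
proof -
  obtain D where D: "D \<in> borel_measurable borel" "\<And>x. 1 / L \<le> D x" "\<And>x. D x \<le> L"
      "distr lborel lborel g = density lborel (\<lambda>x. ennreal (D x))"
    by (rule push_density_exists[OF g L]) (rule that)
  have "0 < 1 / L" using L by (simp add: bilip_bound_def)
  then have "0 \<le> D x" for x using D(2)[of x] by linarith
  from push_density_unique[OF g D(1) this D(4)] show ?thesis
    by eventually_elim (simp add: D)
qed

text \<open>The cocycle identity, which makes \<open>koopman\<close> multiplicative. It comes from
  pushing forward first by \<open>g\<close> and then by \<open>f\<close>.\<close>

lemma push_density_comp:
  assumes f: "f \<in> carrier bilip_bd_group" and g: "g \<in> carrier bilip_bd_group"
  shows "AE x in lborel. push_density (f \<circ> g) x = push_density f x * push_density g (inv_into UNIV f x)"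
proof (rule push_density_unique[OF bilip_bd_group_comp[OF f g]])
  define h where "h = inv_into UNIV f"
  have h: "h \<in> carrier bilip_bd_group" "\<And>x. h (f x) = x"
    using bilip_bd_groupD[OF f] by (simp_all add: h_def)
  note [measurable] = push_density_measurable[OF f] push_density_measurable[OF g]
    bilip_bd_group_measurable[OF f] bilip_bd_group_measurable[OF g] bilip_bd_group_measurable[OF h(1)]
  show "(\<lambda>x. push_density f x * push_density g (inv_into UNIV f x)) \<in> borel_measurable borel"
    unfolding h_def[symmetric] by measurable
  show "0 \<le> push_density f x * push_density g (inv_into UNIV f x)" for x
    by (intro mult_nonneg_nonneg push_density_nonneg f g)
  have "distr lborel lborel (f \<circ> g) = distr (distr lborel lborel g) lborel f"
    by (rule distr_distr[symmetric]) measurable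
  \<comment> \<open>Inserting \<open>h (f x) = x\<close> exhibits the density as a function of
    \<open>f x\<close>, as needed to move it past the push-forward.\<close>
  also have "\<dots> = distr (density lborel (\<lambda>x. ennreal (push_density g (h (f x))))) lborel f"
    by (simp add: distr_eq_push_density[OF g] h)
  also have "\<dots> = density (distr lborel lborel f) (\<lambda>x. ennreal (push_density g (h x)))"
    by (rule density_distr[symmetric]) measurable
  also have "\<dots> = density lborel (\<lambda>x. ennreal (push_density f x) * ennreal (push_density g (h x)))"
    unfolding distr_eq_push_density[OF f] by (rule density_density_eq) measurable
  finally show "distr lborel lborel (f \<circ> g) =
      density lborel (\<lambda>x. ennreal (push_density f x * push_density g (inv_into UNIV f x)))"
    unfolding h_def by (simp add: ennreal_mult push_density_nonneg f g)
qed

lemma push_density_id: "AE x in lborel. push_density id x = 1"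
  by (rule push_density_unique[OF id_in_bilip_bd_group]) (simp_all add: density_1 id_def)

text \<open>The inverse map pushes Lebesgue measure to an absolutely continuous measure, so
  preimages of null sets are null.\<close>

lemma AE_comp_inv:
  assumes g: "g \<in> carrier bilip_bd_group" and P: "AE x in lborel. P x"
  shows "AE x in lborel. P (inv_into UNIV g x)"
proof -
  note h = bilip_bd_groupD(5)[OF g]
  note [measurable] = push_density_measurable[OF h] bilip_bd_group_measurable[OF h]
  from P have "AE x in lborel. 0 < ennreal (push_density (inv_into UNIV g) x) \<longrightarrow> P x"
    by eventually_elim simp
  then have "AE x in distr lborel lborel (inv_into UNIV g). P x"
    unfolding distr_eq_push_density[OF h] by (subst AE_density) measurable
  then show ?thesis by (rule AE_distrD[rotated]) measurable
qed

text \<open>Both sides are integrals of \<open>F \<circ> inv_into UNIV g\<close> against the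
  push-forward measure. The codomain is left general because real and complex integrands both
  occur.\<close>

lemma push_density_change_of_variables:
  fixes F :: "real \<Rightarrow> 'b::{banach, second_countable_topology}"
  assumes g: "g \<in> carrier bilip_bd_group" and F [measurable]: "F \<in> borel_measurable borel"
  shows "integrable lborel (\<lambda>x. push_density g x *\<^sub>R F (inv_into UNIV g x)) \<longleftrightarrow> integrable lborel F" (is ?A)
    and "(LINT x|lborel. push_density g x *\<^sub>R F (inv_into UNIV g x)) = (LINT x|lborel. F x)" (is ?B)
proof -
  note h = bilip_bd_groupD(5)[OF g]
  note [measurable] = push_density_measurable[OF g] bilip_bd_group_measurable[OF g] bilip_bd_group_measurable[OF h]
  have nn: "AE x in lborel. 0 \<le> push_density g x" using push_density_nonneg[OF g] by simp
  have "integrable lborel (\<lambda>x. push_density g x *\<^sub>R F (inv_into UNIV g x)) \<longleftrightarrow>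
      integrable (distr lborel lborel g) (\<lambda>x. F (inv_into UNIV g x))"
    unfolding distr_eq_push_density[OF g] by (rule integrable_density[symmetric, OF _ _ nn]) measurable
  also have "\<dots> \<longleftrightarrow> integrable lborel (\<lambda>x. F (inv_into UNIV g (g x)))"
    by (rule integrable_distr_eq) measurable
  finally show ?A by (simp add: bilip_bd_groupD(6)[OF g])
  have "(LINT x|lborel. push_density g x *\<^sub>R F (inv_into UNIV g x)) =
      (LINT x|distr lborel lborel g. F (inv_into UNIV g x))"
    unfolding distr_eq_push_density[OF g] by (rule integral_density[symmetric, OF _ _ nn]) measurable
  also have "\<dots> = (LINT x|lborel. F (inv_into UNIV g (g x)))"
    by (rule integral_distr) measurable
  finally show ?B by (simp add: bilip_bd_groupD(6)[OF g])
qed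

section \<open>The Koopman representation\<close>

text \<open>The square root is the factor for which products \<open>f * cnj f'\<close> pick up
  exactly the Jacobian. This acts on functions; since the density is a chosen one, the group law
  holds for it almost everywhere only.\<close>

definition koopman :: "(real \<Rightarrow> real) \<Rightarrow> (real \<Rightarrow> complex) \<Rightarrow> real \<Rightarrow> complex" where
  "koopman g f = (\<lambda>x. complex_of_real (sqrt (push_density g x)) * f (inv_into UNIV g x))"

lemma koopman_measurable:
  assumes g: "g \<in> carrier bilip_bd_group" and f [measurable]: "f \<in> borel_measurable borel"
  shows "koopman g f \<in> borel_measurable borel"
proof -
  note [measurable] = push_density_measurable[OF g] bilip_bd_group_measurable[OF bilip_bd_groupD(5)[OF g]]
  show ?thesis unfolding koopman_def by measurable
qed

lemma koopman_mult_cnj: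
  assumes "g \<in> carrier bilip_bd_group"
  shows "koopman g f x * cnj (koopman g f' x) =
    push_density g x *\<^sub>R (f (inv_into UNIV g x) * cnj (f' (inv_into UNIV g x)))"
proof -
  have "complex_of_real (sqrt (push_density g x)) * complex_of_real (sqrt (push_density g x)) =
      complex_of_real (push_density g x)"
    using push_density_nonneg[OF assms, of x] by (simp flip: of_real_mult)
  then show ?thesis by (simp add: koopman_def scaleR_conv_of_real mult_ac)
qed

lemma cmod_koopman_sq:
  assumes "g \<in> carrier bilip_bd_group"
  shows "(cmod (koopman g f x))\<^sup>2 = push_density g x *\<^sub>R (cmod (f (inv_into UNIV g x)))\<^sup>2"
  using push_density_nonneg[OF assms, of x] by (simp add: koopman_def norm_mult power_mult_distrib)

lemma koopman_L2:
  assumes g: "g \<in> carrier bilip_bd_group" and f: "f \<in> L2 lborel"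
  shows "koopman g f \<in> L2 lborel"
proof -
  have [measurable]: "f \<in> borel_measurable borel" using f by (simp add: L2_def)
  have "integrable lborel (\<lambda>x. (cmod (koopman g f x))\<^sup>2)"
    unfolding cmod_koopman_sq[OF g]
    by (subst push_density_change_of_variables(1)[OF g, of "\<lambda>x. (cmod (f x))\<^sup>2"])
      (use f in \<open>simp_all add: L2_def\<close>)
  then show ?thesis using koopman_measurable[OF g] by (simp add: L2_def)
qed

lemma koopman_cong_AE:
  assumes g: "g \<in> carrier bilip_bd_group" and "AE x in lborel. f x = f' x"
  shows "AE x in lborel. koopman g f x = koopman g f' x"
  using AE_comp_inv[OF g assms(2)] by eventually_elim (simp add: koopman_def)

lemma koopman_inner:
  assumes g: "g \<in> carrier bilip_bd_group" and "f \<in> L2 lborel" "f' \<in> L2 lborel"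
  shows "(LINT x|lborel. koopman g f x * cnj (koopman g f' x)) = (LINT x|lborel. f x * cnj (f' x))"
proof -
  have [measurable]: "f \<in> borel_measurable borel" "f' \<in> borel_measurable borel"
    using assms by (simp_all add: L2_def)
  show ?thesis
    unfolding koopman_mult_cnj[OF g]
    by (rule push_density_change_of_variables(2)[OF g, of "\<lambda>x. f x * cnj (f' x)"]) measurable
qed

lemma koopman_comp:
  assumes f: "f \<in> carrier bilip_bd_group" and g: "g \<in> carrier bilip_bd_group"
  shows "AE x in lborel. koopman (f \<circ> g) \<phi> x = koopman f (koopman g \<phi>) x"
  using push_density_comp[OF f g]
proof eventually_elim
  case (elim x)
  have "inv_into UNIV (f \<circ> g) = inv_into UNIV g \<circ> inv_into UNIV f"
    by (intro o_inv_distrib bilip_bd_groupD(2) f g)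
  with elim show ?case by (simp add: koopman_def real_sqrt_mult)
qed

lemma koopman_id: "AE x in lborel. koopman id \<phi> x = \<phi> x"
  using push_density_id by eventually_elim (simp add: koopman_def)

text \<open>The operator induced on classes. It is restricted to the carrier because
  \<open>Bij\<close> requires extensional functions.\<close>

definition koopman_rep :: "(real \<Rightarrow> real) \<Rightarrow> (real \<Rightarrow> complex) \<Rightarrow> real \<Rightarrow> complex" where
  "koopman_rep g = (\<lambda>f\<in>carrier (L2_space lborel). L2_rep lborel (koopman g f))"

text \<open>Lets the operator be computed on an arbitrary representative; well-definedness rests on
  \<open>koopman_cong_AE\<close>.\<close>

lemma koopman_rep_L2_rep:
  assumes g: "g \<in> carrier bilip_bd_group" and f: "f \<in> L2 lborel"
  shows "koopman_rep g (L2_rep lborel f) = L2_rep lborel (koopman g f)"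
  using koopman_cong_AE[OF g L2_rep_AE[OF f]]
  by (simp add: koopman_rep_def L2_rep_carrier[OF f] L2_rep_cong)

lemma L2_space_induct [consumes 1, case_names rep]:
  assumes "f \<in> carrier (L2_space M)" "\<And>f. f \<in> L2 M \<Longrightarrow> P (L2_rep M f)"
  shows "P f"
  using assms by (metis L2_space_carrier)

lemma koopman_rep_closed:
  assumes g: "g \<in> carrier bilip_bd_group" and f: "f \<in> carrier (L2_space lborel)"
  shows "koopman_rep g f \<in> carrier (L2_space lborel)"
  using f by (simp add: koopman_rep_def L2_rep_carrier koopman_L2[OF g] L2_space_in)

lemma koopman_rep_comp:
  assumes f: "f \<in> carrier bilip_bd_group" and g: "g \<in> carrier bilip_bd_group"
    and \<phi>: "\<phi> \<in> carrier (L2_space lborel)"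
  shows "koopman_rep (f \<circ> g) \<phi> = koopman_rep f (koopman_rep g \<phi>)"
  using \<phi>
proof (induction rule: L2_space_induct)
  case (rep \<phi>)
  have "koopman_rep (f \<circ> g) (L2_rep lborel \<phi>) = L2_rep lborel (koopman (f \<circ> g) \<phi>)"
    by (rule koopman_rep_L2_rep[OF bilip_bd_group_comp[OF f g] rep])
  also have "\<dots> = L2_rep lborel (koopman f (koopman g \<phi>))"
    by (rule L2_rep_cong[OF koopman_comp[OF f g]])
  also have "\<dots> = koopman_rep f (koopman_rep g (L2_rep lborel \<phi>))"
    by (simp add: koopman_rep_L2_rep rep f g koopman_L2)
  finally show ?case .
qed

lemma koopman_rep_id: "\<phi> \<in> carrier (L2_space lborel) \<Longrightarrow> koopman_rep id \<phi> = \<phi>"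
  by (induction rule: L2_space_induct)
    (metis koopman_rep_L2_rep id_in_bilip_bd_group L2_rep_cong koopman_id)

lemma koopman_rep_unitary:
  assumes g: "g \<in> carrier bilip_bd_group"
  shows "koopman_rep g \<in> carrier (unitary_group (L2_space lborel))"
proof -
  let ?H = "L2_space lborel :: (real \<Rightarrow> complex) inner_space"
  note h = bilip_bd_groupD(5)[OF g]
  have id: "inv_into UNIV g \<circ> g = id" "g \<circ> inv_into UNIV g = id"
    using bilip_bd_groupD(6,7)[OF g] by (auto simp: fun_eq_iff)
  have "bij_betw (koopman_rep g) (carrier ?H) (carrier ?H)"
    by (rule bij_betw_byWitness[where f' = "koopman_rep (inv_into UNIV g)"])
      (auto simp: koopman_rep_closed g h koopman_rep_comp[symmetric] id koopman_rep_id)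
  then have "koopman_rep g \<in> Bij (carrier ?H)" by (simp add: Bij_def koopman_rep_def)
  moreover have "koopman_rep g (x \<oplus>\<^bsub>?H\<^esub> y) = koopman_rep g x \<oplus>\<^bsub>?H\<^esub> koopman_rep g y"
    if "x \<in> carrier ?H" "y \<in> carrier ?H" for x y
  proof -
    note L = that[THEN L2_space_in]
    have "koopman g (\<lambda>t. x t + y t) = (\<lambda>t. koopman g x t + koopman g y t)"
      by (simp add: koopman_def distrib_left)
    then show ?thesis
      using that L
      by (simp add: L2_space_simps koopman_rep_L2_rep g L2_add)
        (simp add: koopman_rep_def L2_rep_add_left L2_rep_add_right koopman_L2 g)
  qed
  moreover have "koopman_rep g (a \<odot>\<^bsub>?H\<^esub> x) = a \<odot>\<^bsub>?H\<^esub> koopman_rep g x"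
    if "x \<in> carrier ?H" for x a
  proof -
    note L = that[THEN L2_space_in]
    have "koopman g (\<lambda>t. a * x t) = (\<lambda>t. a * koopman g x t)"
      by (simp add: koopman_def mult_ac)
    then show ?thesis
      using that L
      by (simp add: L2_space_simps koopman_rep_L2_rep g L2_scale)
        (simp add: koopman_rep_def L2_rep_scale koopman_L2 g)
  qed
  moreover have "cinner ?H (koopman_rep g x) (koopman_rep g y) = cinner ?H x y"
    if "x \<in> carrier ?H" "y \<in> carrier ?H" for x y
  proof -
    note L = that[THEN L2_space_in]
    note K = koopman_L2[OF g L(1)] koopman_L2[OF g L(2)]
    have [measurable]: "koopman g x \<in> borel_measurable borel" "koopman g y \<in> borel_measurable borel"
      "L2_rep lborel (koopman g x) \<in> borel_measurable borel"
      "L2_rep lborel (koopman g y) \<in> borel_measurable borel"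
      using K K[THEN L2_rep_in] by (simp_all add: L2_def)
    have "(LINT t|lborel. L2_rep lborel (koopman g x) t * cnj (L2_rep lborel (koopman g y) t)) =
        (LINT t|lborel. koopman g x t * cnj (koopman g y t))"
    proof (rule integral_cong_AE)
      show "AE t in lborel. L2_rep lborel (koopman g x) t * cnj (L2_rep lborel (koopman g y) t) =
          koopman g x t * cnj (koopman g y t)"
        using L2_rep_AE[OF K(1)] L2_rep_AE[OF K(2)] by eventually_elim simp
    qed measurable
    also have "\<dots> = (LINT t|lborel. x t * cnj (y t))" by (rule koopman_inner[OF g L])
    finally show ?thesis using that by (simp add: L2_space_simps koopman_rep_def)
  qed
  ultimately show ?thesis by (simp add: unitary_group_def)
qed

lemma koopman_rep_hom:
  assumes "G \<subseteq> carrier bilip_bd_group"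
  shows "koopman_rep \<in> hom (bilip_bd_group\<lparr>carrier := G\<rparr>) (unitary_group (L2_space lborel))"
proof (rule homI)
  fix f g assume "f \<in> carrier (bilip_bd_group\<lparr>carrier := G\<rparr>)" "g \<in> carrier (bilip_bd_group\<lparr>carrier := G\<rparr>)"
  with assms have fg: "f \<in> carrier bilip_bd_group" "g \<in> carrier bilip_bd_group" by auto
  have "koopman_rep (f \<circ> g) = compose (carrier (L2_space lborel)) (koopman_rep f) (koopman_rep g)"
  proof
    fix x
    show "koopman_rep (f \<circ> g) x = compose (carrier (L2_space lborel)) (koopman_rep f) (koopman_rep g) x"
      \<comment> \<open>Off the carrier both sides are \<open>undefined\<close>.\<close>
      by (cases "x \<in> carrier (L2_space lborel)")
        (auto simp: compose_def koopman_rep_comp fg, simp add: koopman_rep_def)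
  qed
  then show "koopman_rep (f \<otimes>\<^bsub>bilip_bd_group\<lparr>carrier := G\<rparr>\<^esub> g) =
      koopman_rep f \<otimes>\<^bsub>unitary_group (L2_space lborel)\<^esub> koopman_rep g"
    by (simp add: unitary_group_mult koopman_rep_unitary fg)
      (simp add: bilip_bd_group_def homeo_plus_def)
qed (use assms koopman_rep_unitary in auto)

section \<open>Absence of invariant vectors\<close>

text \<open>The lower median of the measure is fixed.\<close>

lemma invariant_finite_measure_fixed_point:
  fixes M :: "real measure"
  assumes M: "finite_measure M" "sets M = sets borel" "measure M UNIV \<noteq> 0"
    and \<Gamma>: "\<And>g. g \<in> \<Gamma> \<Longrightarrow> strict_mono g \<and> bij g \<and> distr M M g = M"
  shows "\<exists>x. \<forall>g\<in>\<Gamma>. g x = x"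
proof -
  interpret finite_borel_measure M
    using M by (simp add: finite_borel_measure_def finite_borel_measure_axioms_def)
  define c where "c = measure M UNIV"
  have c: "c > 0" using M(3) measure_nonneg[of M UNIV] by (simp add: c_def order.strict_iff_order)
  have sp: "space M = UNIV" by (rule borel_UNIV)
  \<comment> \<open>The infimum of \<open>X\<close> is the lower median. \<open>X\<close> is
    nonempty and bounded below because the distribution function tends to \<open>c\<close> and to 0
    at the two ends and \<open>0 < c / 2 < c\<close>.\<close>
  define X where "X = {x. c / 2 \<le> cdf M x}"
  have "eventually (\<lambda>x. c / 2 < cdf M x) at_top"
    using c by (intro order_tendstoD(1)[OF cdf_lim_at_top]) (simp add: sp flip: c_def)
  then obtain b where "c / 2 < cdf M b" by (auto simp: eventually_at_top_linorder)
  then have ne: "X \<noteq> {}" by (auto simp: X_def intro: less_imp_le)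
  have "eventually (\<lambda>x. cdf M x < c / 2) at_bot"
    using c by (intro order_tendstoD(2)[OF cdf_lim_at_bot]) simp
  then obtain a where a: "cdf M a < c / 2" by (auto simp: eventually_at_bot_linorder)
  have "a \<le> x" if "x \<in> X" for x
    using that a cdf_nondecreasing[of x a] by (cases "a \<le> x") (auto simp: X_def)
  then have bdd: "bdd_below X" by (rule bdd_belowI)
  have "g (Inf X) = Inf X" if "g \<in> \<Gamma>" for g
  proof (rule antisym)
    have g: "strict_mono g" "bij g" "distr M M g = M" using \<Gamma>[OF that] by auto
    have meas: "g \<in> measurable M M"
      using borel_measurable_mono[OF strict_mono_mono[OF g(1)]] M(2)
      by (simp cong: measurable_cong_sets)
    \<comment> \<open>As \<open>g\<close> is increasing, the preimage of a closed lower ray is again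
      one; invariance of the measure then shows that \<open>g\<close> preserves \<open>X\<close> in
      both directions.\<close>
    have cdf_g: "cdf M (g x) = cdf M x" for x
    proof -
      have "measure M {..g x} = measure (distr M M g) {..g x}" by (simp add: g(3))
      also have "\<dots> = measure M (g -` {..g x})"
        by (subst measure_distr[OF meas]) (simp_all add: M(2) sp)
      also have "g -` {..g x} = {..x}" using strict_mono_less_eq[OF g(1)] by auto
      finally show ?thesis by (simp add: cdf_def)
    qed
    have gX: "g x \<in> X \<longleftrightarrow> x \<in> X" for x by (simp add: X_def cdf_g)
    show "g (Inf X) \<le> Inf X"
    proof (rule cInf_greatest[OF ne])
      fix x assume x: "x \<in> X"
      obtain y where y: "x = g y" using g(2) by (metis bij_pointE)
      then have "Inf X \<le> y" using x gX bdd by (auto intro: cInf_lower)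
      then show "g (Inf X) \<le> x" using strict_mono_less_eq[OF g(1)] y by simp
    qed
    \<comment> \<open>The reverse inequality is pulled back along \<open>g\<close>: the preimage
      \<open>z\<close> of the infimum is itself a lower bound of \<open>X\<close>.\<close>
    obtain z where z: "Inf X = g z" using g(2) by (metis bij_pointE)
    have "z \<le> Inf X"
    proof (rule cInf_greatest[OF ne])
      fix x assume "x \<in> X"
      then have "g z \<le> g x" using gX bdd z by (metis cInf_lower)
      then show "z \<le> x" using strict_mono_less_eq[OF g(1)] by simp
    qed
    then have "g z \<le> g (Inf X)" using strict_mono_less_eq[OF g(1)] by simp
    then show "Inf X \<le> g (Inf X)" by (simp add: z[symmetric])
  qed
  then show ?thesis by blast
qed

text \<open>If \<open>f\<close> is an invariant vector, then the measure with density \<open>|f|\<^sup>2\<close> is invariant.\<close>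

lemma no_invariant_vectors_koopman_rep:
  assumes \<Gamma>: "\<Gamma> \<subseteq> carrier bilip_bd_group" and nofix: "\<not> (\<exists>x. \<forall>g\<in>\<Gamma>. g x = x)"
  shows "no_invariant_vectors (L2_space lborel) koopman_rep \<Gamma>"
  unfolding no_invariant_vectors_def
proof (intro ballI impI, rule ccontr)
  fix f assume f: "f \<in> carrier (L2_space lborel)" and inv: "\<forall>g\<in>\<Gamma>. koopman_rep g f = f"
    and nz: "f \<noteq> \<zero>\<^bsub>L2_space lborel\<^esub>"
  have L: "f \<in> L2 lborel" "L2_rep lborel f = f" using f by (simp_all add: L2_space_carrier)
  have [measurable]: "f \<in> borel_measurable borel" using L by (simp add: L2_def)
  define M where "M = density lborel (\<lambda>x. ennreal ((cmod (f x))\<^sup>2))"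
  have int: "integrable lborel (\<lambda>x. (cmod (f x))\<^sup>2)" by (rule L2_integrable[OF L(1)])
  have sets: "sets M = sets borel" by (simp add: M_def)
  have emM: "emeasure M UNIV = ennreal (LINT x|lborel. (cmod (f x))\<^sup>2)"
    using int by (simp add: M_def emeasure_density nn_integral_eq_integral)
  then have fin: "finite_measure M"
    by (intro finite_measureI) (simp add: M_def)
  have "\<not> (AE x in lborel. f x = 0)"
    using nz L2_rep_cong[of f "\<lambda>x. 0" lborel] L by (auto simp: L2_space_simps)
  then have "\<not> (AE x in lborel. (cmod (f x))\<^sup>2 = 0)" by simp
  then have "(LINT x|lborel. (cmod (f x))\<^sup>2) \<noteq> 0"
    using integral_nonneg_eq_0_iff_AE[OF int] by auto
  then have nz': "measure M UNIV \<noteq> 0"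
    using Bochner_Integration.integral_nonneg[of lborel "\<lambda>x. (cmod (f x))\<^sup>2"]
    by (simp add: measure_def emM)
  have "strict_mono g \<and> bij g \<and> distr M M g = M" if g: "g \<in> \<Gamma>" for g
  proof -
    have gc: "g \<in> carrier bilip_bd_group" using g \<Gamma> by auto
    note h = bilip_bd_groupD(5)[OF gc]
    note [measurable] = push_density_measurable[OF gc] bilip_bd_group_measurable[OF gc]
      bilip_bd_group_measurable[OF h]
    have "AE x in lborel. koopman g f x = f x"
      using L2_rep_AE[OF koopman_L2[OF gc L(1)]] inv g f by (auto simp: koopman_rep_def)
    \<comment> \<open>Squared moduli discard the phase and turn the square root of the density into
      the density itself.\<close>
    then have ae: "AE x in lborel. push_density g x * (cmod (f (inv_into UNIV g x)))\<^sup>2 = (cmod (f x))\<^sup>2"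
      by eventually_elim (metis cmod_koopman_sq[OF gc] real_scaleR_def)
    have "distr M M g = distr (density lborel (\<lambda>x. ennreal ((cmod (f (inv_into UNIV g (g x))))\<^sup>2))) lborel g"
      by (rule distr_cong) (simp_all add: M_def bilip_bd_groupD(6)[OF gc])
    also have "\<dots> = density (distr lborel lborel g) (\<lambda>x. ennreal ((cmod (f (inv_into UNIV g x)))\<^sup>2))"
      by (rule density_distr[symmetric]) measurable
    also have "\<dots> = density lborel (\<lambda>x. ennreal (push_density g x) * ennreal ((cmod (f (inv_into UNIV g x)))\<^sup>2))"
      unfolding distr_eq_push_density[OF gc] by (rule density_density_eq) measurable
    also have "\<dots> = M"
      unfolding M_def
    proof (rule density_cong)
      show "AE x in lborel. ennreal (push_density g x) * ennreal ((cmod (f (inv_into UNIV g x)))\<^sup>2) =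
          ennreal ((cmod (f x))\<^sup>2)"
        using ae by eventually_elim (simp add: ennreal_mult[symmetric] push_density_nonneg[OF gc])
    qed measurable
    finally show ?thesis using bilip_bd_groupD(1,2)[OF gc] by simp
  qed
  then show False
    using invariant_finite_measure_fixed_point[OF fin sets nz', of \<Gamma>] nofix by blast
qed

section \<open>Test vectors\<close>

lemma sqrt_ge_chord:
  fixes y M :: real
  assumes M: "1 \<le> M" and y: "1 / M \<le> y" "y \<le> M"
  shows "sqrt M / (M + 1) * (y + 1) \<le> sqrt y"
proof -
  have y0: "0 < y" using y M by (meson divide_pos_pos less_le_trans zero_less_one)
  define u s where "u = sqrt y" and "s = sqrt M"
  have us: "u > 0" "s \<ge> 1" "u\<^sup>2 = y" "s\<^sup>2 = M" using y0 M by (simp_all add: u_def s_def)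
  have "u \<le> s" using y by (simp add: u_def s_def)
  moreover have "1 \<le> s * u"
  proof -
    have "1 \<le> M * y" using y(1) M by (simp add: field_simps)
    then have "1 \<le> sqrt (M * y)" by simp
    then show ?thesis by (simp add: u_def s_def real_sqrt_mult)
  qed
  \<comment> \<open>Expanded, this product is the claim. Its zeros \<open>u = 1 / s\<close> and
    \<open>u = s\<close> are the endpoints \<open>y = 1 / M\<close> and \<open>y = M\<close>, where
    the chord meets the graph.\<close>
  ultimately have "0 \<le> (s * u - 1) * (s - u)" by (intro mult_nonneg_nonneg) auto
  then have "s * (u\<^sup>2 + 1) \<le> u * (s\<^sup>2 + 1)" by (simp add: algebra_simps power2_eq_square)
  then have "s * (y + 1) \<le> u * (M + 1)" by (simp only: us)
  then have "s / (M + 1) * (y + 1) \<le> u" using M by (simp add: pos_divide_le_eq)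
  then show ?thesis by (simp only: u_def s_def)
qed

text \<open>The difference of the two sides vanishes at 1 and has derivative
  \<open>(t - 1)^2 / (2 * t * (t + 1)^2)\<close>.\<close>

lemma half_ln_ge:
  fixes x :: real
  assumes "1 \<le> x"
  shows "(x - 1) / (x + 1) \<le> ln x / 2"
proof -
  have "ln 1 / 2 - (1 - 1) / (1 + 1) \<le> ln x / 2 - (x - 1) / (x + 1)"
  proof (rule DERIV_nonneg_imp_nondecreasing[OF assms])
    fix t :: real assume t: "1 \<le> t" "t \<le> x"
    have "((\<lambda>t. ln t / 2 - (t - 1) / (t + 1)) has_real_derivative
        (1 / t / 2 - (1 * (t + 1) - (t - 1) * 1) / ((t + 1) * (t + 1)))) (at t)"
      using t by (auto intro!: derivative_eq_intros)
    moreover have "1 / t / 2 - (1 * (t + 1) - (t - 1) * 1) / ((t + 1) * (t + 1)) = (t - 1)\<^sup>2 / (2 * t * (t + 1)\<^sup>2)"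
      using t by (simp add: divide_simps power2_eq_square) (simp add: algebra_simps)
    ultimately show "\<exists>y. ((\<lambda>t. ln t / 2 - (t - 1) / (t + 1)) has_real_derivative y) (at t) \<and> 0 \<le> y"
      using t by auto
  qed
  then show ?thesis by simp
qed

lemma Phi_le:
  fixes M k :: real
  assumes M: "1 \<le> M" and k: "0 \<le> k" "k\<^sup>2 \<le> 2 - 4 * sqrt M / (M + 1)"
  shows "Phi k \<le> M"
proof -
  define s q where "s = sqrt M" and "q = s\<^sup>2 + 1"
  have s: "1 \<le> s" "M = s\<^sup>2" using M by (simp_all add: s_def)
  have q: "0 < q" by (simp add: q_def add_nonneg_pos)
  \<comment> \<open>Exponential bound: the right-hand side is \<open>2 * (s - 1)^2 / q\<close>, and
    \<open>(s + 1)^2 <= 2 * q\<close> makes it at most the square of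
    \<open>2 * (s - 1) / (s + 1)\<close>, which is at most \<open>ln s\<close>. Then
    \<open>exp (2 * k) <= s^2 = M\<close>.\<close>
  have k': "k\<^sup>2 \<le> 2 - 4 * s / q" using k(2) M by (simp add: s_def q_def)
  also have "\<dots> = (2 * q - 4 * s) / q" using q by (simp add: diff_divide_distrib)
  also have "2 * q - 4 * s = 2 * (s - 1)\<^sup>2" by (simp add: q_def power2_eq_square algebra_simps)
  also have "2 * (s - 1)\<^sup>2 / q = (s - 1)\<^sup>2 * (4 / (2 * q))" by simp
  also have "\<dots> \<le> (s - 1)\<^sup>2 * (4 / (s + 1)\<^sup>2)"
  proof (intro mult_left_mono divide_left_mono)
    show "(s + 1)\<^sup>2 \<le> 2 * q" using sum_squares_bound[of s 1] by (simp add: q_def power2_sum)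
  qed (use s q in auto)
  also have "\<dots> = (2 * ((s - 1) / (s + 1)))\<^sup>2"
    unfolding power_mult_distrib power_divide by simp
  finally have "k\<^sup>2 \<le> (2 * ((s - 1) / (s + 1)))\<^sup>2" .
  then have "k \<le> 2 * ((s - 1) / (s + 1))"
    by (rule power2_le_imp_le) (use s(1) in simp)
  also have "\<dots> \<le> ln s" using half_ln_ge[OF s(1)] by linarith
  finally have "exp (2 * k) \<le> exp (2 * ln s)" by simp
  also have "\<dots> = M" using s(1) by (simp only: exp_double exp_ln[of s] s(2))
  finally have 1: "exp (2 * k) \<le> M" .
  \<comment> \<open>Rational bound: \<open>q <= 2 * s^2\<close> gives
    \<open>2 - k^2 >= 4 * s / q >= 2 / s\<close>, and squaring yields \<open>4 / M\<close>.\<close>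
  have "2 * q \<le> 4 * s * s" using one_le_power[OF s(1), of 2] by (simp add: q_def power2_eq_square)
  then have "2 / s \<le> 4 * s / q" using s(1) q by (simp add: frac_le_eq divide_nonpos_pos)
  then have a: "2 / s \<le> 2 - k\<^sup>2" using k' by simp
  have "(2 / s)\<^sup>2 \<le> (2 - k\<^sup>2)\<^sup>2" using a s(1) by (intro power_mono) auto
  then have "4 / M \<le> (2 - k\<^sup>2)\<^sup>2" by (simp add: s power_divide)
  moreover have "0 < 2 - k\<^sup>2" using a s(1) by (meson divide_pos_pos less_le_trans zero_less_numeral zero_less_one)
  ultimately have "4 / (2 - k\<^sup>2)\<^sup>2 \<le> M" using M by (simp add: field_simps)
  then have "4 * (2 - k\<^sup>2) powi (-2) \<le> M" by (simp add: power_int_minus divide_inverse)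
  with 1 show ?thesis by (simp add: Phi_def)
qed

section \<open>Displacement of indicators of long intervals\<close>

definition box_vector :: "real \<Rightarrow> real \<Rightarrow> complex" where
  "box_vector r = (\<lambda>x. complex_of_real (indicator {-r..r} x))"

lemma cmod_box_vector_sq: "(cmod (box_vector r x))\<^sup>2 = indicator {-r..r} x"
  by (simp add: box_vector_def indicator_def)

lemma integrable_lborel_Icc: "integrable lborel (indicator {a..b::real} :: real \<Rightarrow> real)"
  by (rule integrable_real_indicator) (auto simp: emeasure_lborel_Icc_eq)

lemma box_vector_L2: "box_vector r \<in> L2 lborel"
proof -
  have "box_vector r \<in> borel_measurable borel" unfolding box_vector_def by measurable
  then show ?thesis by (simp add: L2_def cmod_box_vector_sq integrable_lborel_Icc)
qed

lemma hnorm_box_vector: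
  assumes "0 \<le> r"
  shows "hnorm (L2_space lborel) (L2_rep lborel (box_vector r)) = sqrt (2 * r)"
  using assms by (simp add: hnorm_L2_rep[OF box_vector_L2] cmod_box_vector_sq)

text \<open>Expanding the square gives two terms of integral \<open>2 * r\<close> each and a cross
  term with \<open>sqrt D\<close>. The chord bounds the cross term below by an expression linear in
  \<open>D\<close>, whose integral over an interval is controlled through the displacement of
  \<open>g\<close>.\<close>

lemma koopman_box_vector_displacement:
  assumes g: "g \<in> carrier bilip_bd_group" and M: "bilip_bound g M"
    and C: "\<And>x. \<bar>g x - x\<bar> \<le> C" and r: "2 * C \<le> r"
  shows "(LINT x|lborel. (cmod (koopman g (box_vector r) x - box_vector r x))\<^sup>2) \<le>
    4 * r - 2 * (sqrt M / (M + 1)) * (4 * r - 6 * C)"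
proof -
  define h where "h = inv_into UNIV g"
  define D where "D = push_density g"
  define c where "c = sqrt M / (M + 1)"
  have M1: "1 \<le> M" using M by (simp add: bilip_bound_def)
  have c: "0 \<le> c" using M1 by (simp add: c_def)
  have C0: "0 \<le> C" using C[of 0] by linarith
  have hC: "\<bar>h x - x\<bar> \<le> C" for x
    using C[of "h x"] bilip_bd_groupD(7)[OF g, of x] by (simp add: h_def abs_minus_commute)
  have hg: "h (g x) = x" "g (h x) = x" for x using bilip_bd_groupD(6,7)[OF g] by (simp_all add: h_def)
  note meas_g [measurable] = bilip_bd_group_measurable[OF g]
  have [measurable]: "D \<in> borel_measurable borel" unfolding D_def by (rule push_density_measurable[OF g])
  have D0: "0 \<le> D x" for x by (simp add: D_def push_density_nonneg[OF g])
  \<comment> \<open>Each shrinking by \<open>C\<close> absorbs one application of \<open>g\<close>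
    or \<open>h\<close>: \<open>h\<close> maps \<open>?J\<close> into \<open>?I\<close>, and
    \<open>g\<close> maps \<open>?J'\<close> into \<open>?J\<close>. The hypothesis
    \<open>2 * C \<le> r\<close> keeps the lengths nonnegative.\<close>
  let ?I = "{- r..r}" and ?J = "{- (r - C)..r - C}" and ?J' = "{- (r - 2 * C)..r - 2 * C}"
  note cv = push_density_change_of_variables[OF g, folded h_def D_def, where 'b = real, unfolded real_scaleR_def]
  have I_int: "integrable lborel (indicator ?I :: real \<Rightarrow> real)" by (rule integrable_lborel_Icc)
  have DI: "integrable lborel (\<lambda>x. D x * indicator ?I (h x))"
    "(LINT x|lborel. D x * indicator ?I (h x)) = 2 * r"
    using cv[of "indicator ?I"] r C0 by simp_all
  have sub: "(indicator ?J (g x) :: real) \<le> indicator ?I x"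
    "(indicator ?J' x :: real) \<le> indicator ?J (g x)" for x
    using C[of x] by (auto simp: indicator_def abs_le_iff)
  have Jg: "integrable lborel (\<lambda>x. indicator ?J (g x) :: real)"
    by (rule Bochner_Integration.integrable_bound[OF I_int]) (use sub(1) in auto)
  \<comment> \<open>The mass of \<open>?J\<close> under the push-forward is the length of its
    preimage, which contains \<open>?J'\<close>; this is where bounded displacement forces the mean
    of \<open>D\<close> to be near 1.\<close>
  have DJ: "integrable lborel (\<lambda>x. D x * indicator ?J x)"
    "(LINT x|lborel. D x * indicator ?J x) = (LINT x|lborel. indicator ?J (g x))"
    using cv[of "\<lambda>x. indicator ?J (g x)"] Jg by (simp_all add: hg)
  have "2 * (r - 2 * C) = (LINT x|lborel. indicator ?J' x)" using r by simp
  also have "\<dots> \<le> (LINT x|lborel. indicator ?J (g x))"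
    by (intro integral_mono Jg sub integrable_lborel_Icc)
  also have "\<dots> = (LINT x|lborel. D x * indicator ?J x)" by (rule DJ(2)[symmetric])
  finally have low: "2 * (r - 2 * C) \<le> (LINT x|lborel. D x * indicator ?J x)" .
  have J_int: "integrable lborel (indicator ?J :: real \<Rightarrow> real)" by (rule integrable_lborel_Icc)
  have J_val: "(LINT x|lborel. indicator ?J x) = 2 * (r - C)" using r C0 by simp
  have "(LINT x|lborel. (cmod (koopman g (box_vector r) x - box_vector r x))\<^sup>2) \<le>
      (LINT x|lborel. D x * indicator ?I (h x) + indicator ?I x
        - 2 * c * (D x * indicator ?J x + indicator ?J x))"
  proof (rule integral_mono_AE)
    show "integrable lborel (\<lambda>x. (cmod (koopman g (box_vector r) x - box_vector r x))\<^sup>2)"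
      by (intro L2_integrable L2_diff koopman_L2 g box_vector_L2)
    show "integrable lborel (\<lambda>x. D x * indicator ?I (h x) + indicator ?I x
        - 2 * c * (D x * indicator ?J x + indicator ?J x))"
      by (intro Bochner_Integration.integrable_diff Bochner_Integration.integrable_add
          integrable_mult_right DI DJ I_int J_int)
    show "AE x in lborel. (cmod (koopman g (box_vector r) x - box_vector r x))\<^sup>2 \<le>
        D x * indicator ?I (h x) + indicator ?I x - 2 * c * (D x * indicator ?J x + indicator ?J x)"
      using push_density_bounds[OF g M]
    proof eventually_elim
      case (elim x)
      have s: "c * (D x + 1) \<le> sqrt (D x)"
        using sqrt_ge_chord[OF M1] elim by (simp add: c_def D_def)
      \<comment> \<open>On \<open>?J\<close> both indicators equal 1, so restricting the cross term
        to \<open>?J\<close> only decreases it.\<close>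
      have J: "(indicator ?J x :: real) \<le> indicator ?I (h x) * indicator ?I x"
        using hC[of x] C0 by (auto simp: indicator_def abs_le_iff)
      have "koopman g (box_vector r) x - box_vector r x =
          complex_of_real (sqrt (D x) * indicator ?I (h x) - indicator ?I x)"
        by (simp add: koopman_def box_vector_def D_def h_def)
      then have "(cmod (koopman g (box_vector r) x - box_vector r x))\<^sup>2 =
          (sqrt (D x) * indicator ?I (h x) - indicator ?I x)\<^sup>2"
        by (simp only: norm_of_real power2_abs)
      also have "\<dots> = D x * indicator ?I (h x) + indicator ?I x
          - 2 * (sqrt (D x) * (indicator ?I (h x) * indicator ?I x))"
        using D0[of x] by (simp add: power2_diff power_mult_distrib indicator_def)
      also have "\<dots> \<le> D x * indicator ?I (h x) + indicator ?I x
          - 2 * (c * (D x + 1) * indicator ?J x)"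
        using mult_mono[OF s J] D0[of x] by simp
      finally show ?case by (simp add: algebra_simps)
    qed
  qed
  also have "\<dots> = 2 * r + 2 * r - 2 * c * ((LINT x|lborel. D x * indicator ?J x) + 2 * (r - C))"
    by (simp only: Bochner_Integration.integral_diff Bochner_Integration.integral_add
        Bochner_Integration.integral_mult_right_zero Bochner_Integration.integrable_diff
        Bochner_Integration.integrable_add integrable_mult_right DI DJ(1) I_int J_int J_val)
      (use r C0 in simp)
  also have "\<dots> \<le> 2 * r + 2 * r - 2 * c * (2 * (r - 2 * C) + 2 * (r - C))"
    using low c by (intro diff_left_mono mult_left_mono add_right_mono) auto
  also have "\<dots> = 4 * r - 2 * c * (4 * r - 6 * C)" by (simp add: algebra_simps)
  finally show ?thesis by (simp add: c_def)
qed

lemma hnorm_koopman_rep_displacement: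
  assumes g: "g \<in> carrier bilip_bd_group" and f: "f \<in> L2 lborel"
  shows "hnorm (L2_space lborel)
      (koopman_rep g (L2_rep lborel f) \<ominus>\<^bsub>L2_space lborel\<^esub> L2_rep lborel f) =
    sqrt (LINT x|lborel. (cmod (koopman g f x - f x))\<^sup>2)"
proof -
  note K = koopman_L2[OF g f]
  have "L2_rep lborel (\<lambda>x. L2_rep lborel (koopman g f) x - L2_rep lborel f x) =
      L2_rep lborel (\<lambda>x. koopman g f x - f x)"
    using L2_rep_AE[OF K] L2_rep_AE[OF f] by (intro L2_rep_cong) auto
  then show ?thesis
    by (simp add: koopman_rep_L2_rep[OF g f] L2_space_minus L2_rep_carrier K f hnorm_L2_rep L2_diff)
qed

section \<open>The inequality for Kazhdan pairs and the resulting bound\<close>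

lemma kazhdan_pair_le:
  assumes G: "subgroup G bilip_bd_group" and \<Gamma>: "\<Gamma> \<subseteq> G" and nofix: "\<not> (\<exists>x. \<forall>g\<in>\<Gamma>. g x = x)"
    and S: "finite S" "S \<subseteq> G" and M: "1 \<le> M" "\<And>g. g \<in> S \<Longrightarrow> bilip_bound g M"
    and kaz: "kazhdan_pair (bilip_bd_group\<lparr>carrier := G\<rparr>) \<Gamma> S \<epsilon>" and \<epsilon>: "0 \<le> \<epsilon>"
  shows "\<epsilon>\<^sup>2 \<le> 2 - 4 * sqrt M / (M + 1)"
proof (rule ccontr)
  let ?H = "L2_space lborel :: (real \<Rightarrow> complex) inner_space"
  define c where "c = sqrt M / (M + 1)"
  assume "\<not> ?thesis"
  \<comment> \<open>The limit in \<open>r\<close> is replaced by a contradiction: a positive gap is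
    violated by one sufficiently long interval.\<close>
  then have gap: "0 < \<epsilon>\<^sup>2 - 2 + 4 * c" by (simp add: c_def)
  have GB: "G \<subseteq> carrier bilip_bd_group" using subgroup.subset[OF G] .
  have c: "0 \<le> c" "2 * c \<le> 1"
  proof -
    show "0 \<le> c" using M(1) by (simp add: c_def)
    have "2 * sqrt M \<le> M + 1" using sum_squares_bound[of "sqrt M" 1] M(1) by simp
    then show "2 * c \<le> 1" using M(1) by (simp add: c_def divide_le_eq)
  qed
  have "\<exists>C. \<forall>x. \<bar>g x - x\<bar> \<le> C" if "g \<in> S" for g
    using bilip_bd_groupD(4)[of g] that S(2) GB by (auto simp: bounded_displacement_def bdd_above_def)
  then obtain C' where C': "\<And>g x. g \<in> S \<Longrightarrow> \<bar>g x - x\<bar> \<le> C' g" by metis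
  \<comment> \<open>A displacement bound common to all of \<open>S\<close>; the inserted 0 covers
    empty \<open>S\<close> and gives \<open>0 \<le> C\<close>.\<close>
  define C where "C = Max (insert 0 (C' ` S))"
  have C0: "0 \<le> C" using S(1) by (simp add: C_def)
  have C: "\<bar>g x - x\<bar> \<le> C" if "g \<in> S" for g x
  proof -
    have "C' g \<le> C" using S(1) that by (simp add: C_def)
    then show ?thesis using C'[OF that, of x] by simp
  qed
  \<comment> \<open>The last summand times the gap is exactly \<open>6 * c * C\<close>; the summands
    \<open>2 * C + 1\<close> give \<open>2 * C \<le> r\<close> and make the comparison
    strict.\<close>
  define r where "r = 2 * C + 1 + 6 * c * C / (\<epsilon>\<^sup>2 - 2 + 4 * c)"
  have r: "2 * C \<le> r" "0 < r" "6 * c * C < (\<epsilon>\<^sup>2 - 2 + 4 * c) * r"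
    using gap C0 c by (simp_all add: r_def distrib_left add_nonneg_pos add_pos_nonneg)
  define R where "R = 4 * r - 2 * c * (4 * r - 6 * C)"
  \<comment> \<open>As \<open>2 * c \<le> 1\<close>, \<open>R\<close> is at least
    \<open>6 * C\<close>. Its nonnegativity handles the entry 0 in \<open>max_displacement\<close>
    and the squaring of \<open>sqrt R\<close>.\<close>
  have "(2 * c) * (4 * r - 6 * C) \<le> 1 * (4 * r - 6 * C)"
    using c r C0 by (intro mult_right_mono) auto
  then have R0: "0 \<le> R" using C0 by (simp add: R_def)
  define \<xi> where "\<xi> = L2_rep lborel (box_vector r)"
  \<comment> \<open>The vectors here are functions on the line, while \<open>kazhdan_pair\<close>
    speaks of functions on the group; hence the transfer between underlying types.\<close>
  have "\<epsilon> * hnorm ?H \<xi> \<le> max_displacement ?H koopman_rep S \<xi>"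
  proof (rule kazhdan_pair_all_types[OF _ _ _ kaz])
    show "group (bilip_bd_group\<lparr>carrier := G\<rparr>)"
      by (rule group.subgroup_imp_group[OF group_bilip_bd G])
    show "complex_hilbert_space ?H"
      by (rule sigma_finite_measure.complex_hilbert_space_L2[OF lborel.sigma_finite_measure_axioms])
    show "koopman_rep \<in> hom (bilip_bd_group\<lparr>carrier := G\<rparr>) (unitary_group ?H)"
      by (rule koopman_rep_hom[OF GB])
    show "no_invariant_vectors ?H koopman_rep \<Gamma>"
      using \<Gamma> GB nofix by (intro no_invariant_vectors_koopman_rep) auto
    show "\<xi> \<in> carrier ?H" unfolding \<xi>_def by (rule L2_rep_carrier[OF box_vector_L2])
  qed (use \<Gamma> S in auto)
  also have "max_displacement ?H koopman_rep S \<xi> \<le> sqrt R"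
    unfolding max_displacement_def
  proof (rule Max.boundedI)
    fix a assume "a \<in> insert 0 ((\<lambda>g. hnorm ?H (koopman_rep g \<xi> \<ominus>\<^bsub>?H\<^esub> \<xi>)) ` S)"
    then consider "a = 0" | g where "g \<in> S" "a = hnorm ?H (koopman_rep g \<xi> \<ominus>\<^bsub>?H\<^esub> \<xi>)" by auto
    then show "a \<le> sqrt R"
    proof cases
      case 1
      then show ?thesis using R0 by simp
    next
      case (2 g)
      have g: "g \<in> carrier bilip_bd_group" using 2(1) S(2) GB by auto
      show ?thesis
        using koopman_box_vector_displacement[OF g M(2)[OF 2(1)] C[OF 2(1)] r(1)]
        by (simp add: 2(2) \<xi>_def hnorm_koopman_rep_displacement[OF g box_vector_L2] R_def c_def)
    qed
  qed (use S(1) in auto)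
  finally have "\<epsilon> * sqrt (2 * r) \<le> sqrt R"
    using r(2) by (simp add: \<xi>_def hnorm_box_vector)
  then have "(\<epsilon> * sqrt (2 * r))\<^sup>2 \<le> (sqrt R)\<^sup>2"
    using \<epsilon> r(2) by (intro power_mono) auto
  then have "\<epsilon>\<^sup>2 * (2 * r) \<le> R" using R0 r(2) by (simp add: power_mult_distrib)
  then have "(\<epsilon>\<^sup>2 - 2 + 4 * c) * r \<le> 6 * c * C" by (simp add: R_def algebra_simps)
  with r(3) show False by simp
qed

theorem theorem1p4:
  fixes G \<Gamma> S :: "(real \<Rightarrow> real) set"
  assumes "subgroup G bilip_bd_group"
    and "\<exists>S\<^sub>0. finite_generating_set (bilip_bd_group\<lparr>carrier := G\<rparr>) S\<^sub>0"
    and "subgroup \<Gamma> (bilip_bd_group\<lparr>carrier := G\<rparr>)"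
    and "\<not> (\<exists>x\<^sub>0. \<forall>g\<in>\<Gamma>. g x\<^sub>0 = x\<^sub>0)"
    and "property_T (bilip_bd_group\<lparr>carrier := G\<rparr>) \<Gamma>"
    and "finite_generating_set (bilip_bd_group\<lparr>carrier := G\<rparr>) S"
  shows "kazhdan_constant (bilip_bd_group\<lparr>carrier := G\<rparr>) \<Gamma> S \<in> {0..<ereal (sqrt 2)} \<and>
    (MAX g\<in>S. BiLip g) \<ge>
      Phi (real_of_ereal (kazhdan_constant (bilip_bd_group\<lparr>carrier := G\<rparr>) \<Gamma> S))"
proof -
  let ?G = "bilip_bd_group\<lparr>carrier := G\<rparr>"
  define M where "M = (MAX g\<in>S. BiLip g)"
  define \<kappa> where "\<kappa> = kazhdan_constant ?G \<Gamma> S"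
  have S: "finite S" "S \<subseteq> G" "generate ?G S = G"
    using assms(6) by (auto simp: finite_generating_set_def)
  have \<Gamma>: "\<Gamma> \<subseteq> G" using subgroup.subset[OF assms(3)] by simp
  \<comment> \<open>An empty \<open>S\<close> would generate the trivial group, which fixes 0.
    Nonemptiness gives the maximum over \<open>S\<close> its meaning.\<close>
  have "S \<noteq> {}"
  proof
    assume "S = {}"
    then have "G = {id}"
      using S(3) group.generate_empty[OF group.subgroup_imp_group[OF group_bilip_bd assms(1)]]
      by (simp add: bilip_bd_group_def homeo_plus_def)
    with \<Gamma> have "\<forall>g\<in>\<Gamma>. g 0 = 0" by auto
    with assms(4) show False by blast
  qed
  have bil: "bilip_bound g (BiLip g)" if "g \<in> S" for g
    using that S(2) subgroup.subset[OF assms(1)] bilip_bd_groupD(3)[of g] by (auto intro: bilip_bound_BiLip)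
  have bilM: "bilip_bound g M" if "g \<in> S" for g
    by (rule bilip_bound_mono[OF bil[OF that]]) (use S(1) that in \<open>simp add: M_def\<close>)
  then have M1: "1 \<le> M" using \<open>S \<noteq> {}\<close> by (auto simp: bilip_bound_def)
  \<comment> \<open>The largest \<epsilon> that \<open>kazhdan_pair_le\<close> permits. It lies
    below \<open>sqrt 2\<close> because the subtracted term is positive, which places the Kazhdan
    constant in the domain of \<open>Phi\<close>.\<close>
  define k where "k = sqrt (2 - 4 * sqrt M / (M + 1))"
  have "2 * sqrt M \<le> M + 1" using sum_squares_bound[of "sqrt M" 1] M1 by simp
  then have "4 * sqrt M / (M + 1) \<le> 2" using M1 by (simp add: divide_le_eq)
  moreover have "0 < 4 * sqrt M / (M + 1)" using M1 by simp
  ultimately have k: "k\<^sup>2 = 2 - 4 * sqrt M / (M + 1)" "0 \<le> k" "k < sqrt 2"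
    by (simp_all add: k_def)
  have up: "\<kappa> \<le> ereal k"
    unfolding \<kappa>_def kazhdan_constant_def
  proof (rule Sup_least)
    fix e assume "e \<in> {ereal \<epsilon> |\<epsilon>. 0 \<le> \<epsilon> \<and> kazhdan_pair ?G \<Gamma> S \<epsilon>}"
    then obtain \<epsilon> where \<epsilon>: "e = ereal \<epsilon>" "0 \<le> \<epsilon>" "kazhdan_pair ?G \<Gamma> S \<epsilon>" by auto
    have "\<epsilon>\<^sup>2 \<le> k\<^sup>2"
      unfolding k(1) by (rule kazhdan_pair_le[OF assms(1) \<Gamma> assms(4) S(1,2) M1 bilM \<epsilon>(3,2)])
    then have "\<epsilon> \<le> k" using k(2) by (rule power2_le_imp_le)
    then show "e \<le> ereal k" by (simp add: \<epsilon>(1))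
  qed
  \<comment> \<open>Property (T) supplies a member of the set of admissible constants, so the
    supremum is nonnegative; with the upper bound \<open>k\<close> it is a real number.\<close>
  obtain \<epsilon> where "0 < \<epsilon>" "kazhdan_pair ?G \<Gamma> S \<epsilon>"
    using assms(5,6) by (auto simp: property_T_def)
  then have "ereal \<epsilon> \<le> \<kappa>"
    unfolding \<kappa>_def kazhdan_constant_def by (intro Sup_upper) auto
  with \<open>0 < \<epsilon>\<close> have "0 \<le> \<kappa>" by (meson ereal_less_eq(5) less_imp_le order_trans)
  with up obtain t where t: "\<kappa> = ereal t" "0 \<le> t" "t \<le> k" by (cases \<kappa>) auto
  \<comment> \<open>The inequality passes from \<open>k\<close> down to the Kazhdan constant itself,
    so \<open>Phi_le\<close> applies to \<open>t\<close> directly and monotonicity of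
    \<open>Phi\<close> does not enter.\<close>
  have "t\<^sup>2 \<le> 2 - 4 * sqrt M / (M + 1)" using power_mono[OF t(3,2), of 2] by (simp add: k)
  then have "Phi t \<le> M" by (rule Phi_le[OF M1 t(2)])
  then show ?thesis
    using t k(3) by (simp add: \<kappa>_def[symmetric] M_def[symmetric])
qed

end
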